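(* For every $\Lambda_3>0$ there exists a constant $\epsilon_2=\epsilon_2(\Lambda_3)>0$ such that the following holds. Let $g=e^{2u}g_{euc}$ be a smooth metric on $D_4\setminus D_{1/4}$ with $$\|\nabla u\|_{L^{2,\infty}(D_4\setminus D_{1/4})}<\Lambda_3,$$ and let $c$ be the mean value of $u$ on the circle $\partial D_{3/2}$. If $$\int_{D_4\setminus D_{1/2}}|K|e^{2u}\,dx\,dy<\epsilon_2,$$ then $$C_1\le\frac{d_g(e^{i\theta},2e^{i\theta'})}{e^{c}}\le C_2\qquad\text{for all }\theta,\theta'\in\mathbb{R},$$ and $$C_1'\le\frac{\mu(D_2\setminus D,g)}{e^{2c}}\le C_2',$$ where the positive constants $C_1,C_1',C_2,C_2'$ depend only on $\Lambda_3$ and $\epsilon_2$.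
   Context: $D_r$ is the open Euclidean disk of radius $r$ centred at $0$ in $\mathbb{C}=\mathbb{R}^2$, $D=D_1$, $g_{euc}=dx^2+dy^2$. For $g=e^{2u}g_{euc}$: $K=K(g)=-e^{-2u}\Delta u$ is the Gauss curvature, $d_g$ the distance function of $g$, and $\mu(A,g)=\int_Ae^{2u}dx\,dy$ the area. $L^{2,\infty}$ is the Lorentz (weak-$L^2$) space. *)

theory Defs
  imports "HOL-Analysis.Analysis"
begin

text \<open>
  The plane is \<^typ>\<open>complex\<close>, and \<open>D\<^sub>r\<close> is \<open>ball 0 r\<close>. A conformal metric \<open>e\<^sup>2\<^sup>u g\<^sub>e\<^sub>u\<^sub>c\<close> on a
  set \<open>A\<close> is represented by its exponent \<open>u\<close>.
\<close>

fun C_k_on :: "nat \<Rightarrow> (complex \<Rightarrow> real) \<Rightarrow> complex set \<Rightarrow> bool" where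
  "C_k_on 0 f U \<longleftrightarrow> continuous_on U f"
| "C_k_on (Suc k) f U \<longleftrightarrow>
     f differentiable_on U \<and> (\<forall>v. C_k_on k (\<lambda>z. frechet_derivative f (at z) v) U)"

text \<open>
  \<open>A\<close> need not be open (the annuli below contain their inner boundary circle), so smoothness
  on \<open>A\<close> means smoothness on an open neighbourhood of \<open>A\<close>. In particular the derivatives of a
  smooth function are determined by its germ at each point of \<open>A\<close>.
\<close>
definition smooth_on :: "complex set \<Rightarrow> (complex \<Rightarrow> real) \<Rightarrow> bool" where
  "smooth_on A f \<longleftrightarrow> (\<exists>U. open U \<and> A \<subseteq> U \<and> (\<forall>k. C_k_on k f U))"

definition dx :: "(complex \<Rightarrow> real) \<Rightarrow> complex \<Rightarrow> real" where
  "dx f z = frechet_derivative f (at z) 1"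

definition dy :: "(complex \<Rightarrow> real) \<Rightarrow> complex \<Rightarrow> real" where
  "dy f z = frechet_derivative f (at z) \<i>"

definition grad :: "(complex \<Rightarrow> real) \<Rightarrow> complex \<Rightarrow> complex" where
  "grad f z = Complex (dx f z) (dy f z)"

definition laplacian :: "(complex \<Rightarrow> real) \<Rightarrow> complex \<Rightarrow> real" where
  "laplacian f z = dx (dx f) z + dy (dy f) z"

definition gauss_curvature :: "(complex \<Rightarrow> real) \<Rightarrow> complex \<Rightarrow> real" where
  "gauss_curvature u z = - exp (- 2 * u z) * laplacian u z"

text \<open>
  The weak-\<open>L\<^sup>2\<close> quasi-norm \<open>sup\<^sub>t t |{|f| > t}|\<^sup>1\<^sup>/\<^sup>2\<close>, written as the least constant \<open>C\<close> with
  \<open>|{|f| > t}| \<le> C\<^sup>2 / t\<^sup>2\<close> for all \<open>t > 0\<close>; it is \<open>\<infinity>\<close> if \<open>f\<close> is not in weak \<open>L\<^sup>2\<close>.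
\<close>
definition weak_L2_norm :: "complex set \<Rightarrow> (complex \<Rightarrow> complex) \<Rightarrow> ennreal" where
  "weak_L2_norm A f =
     Inf {C. \<forall>t>0. emeasure lborel {z \<in> A. norm (f z) > t} \<le> C\<^sup>2 / ennreal (t\<^sup>2)}"

text \<open>
  Lengths are Lebesgue integrals in \<^typ>\<open>ennreal\<close>, since \<^const>\<open>valid_path\<close> does not bound the
  derivative near the break points: a path of infinite length has length \<open>\<infinity>\<close> and does not
  contribute to the distance.
\<close>
definition conf_length :: "(complex \<Rightarrow> real) \<Rightarrow> (real \<Rightarrow> complex) \<Rightarrow> ennreal" where
  "conf_length u \<gamma> =
     (\<integral>\<^sup>+t\<in>{0..1}. ennreal (exp (u (\<gamma> t)) * norm (vector_derivative \<gamma> (at t))) \<partial>lborel)"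

definition conf_dist :: "complex set \<Rightarrow> (complex \<Rightarrow> real) \<Rightarrow> complex \<Rightarrow> complex \<Rightarrow> ennreal" where
  "conf_dist A u x y =
     (INF \<gamma> \<in> {\<gamma>. valid_path \<gamma> \<and> path_image \<gamma> \<subseteq> A \<and> pathstart \<gamma> = x \<and> pathfinish \<gamma> = y}.
        conf_length u \<gamma>)"

definition conf_area :: "(complex \<Rightarrow> real) \<Rightarrow> complex set \<Rightarrow> ennreal" where
  "conf_area u B = (\<integral>\<^sup>+z\<in>B. ennreal (exp (2 * u z)) \<partial>lborel)"

definition circle_mean :: "(complex \<Rightarrow> real) \<Rightarrow> real \<Rightarrow> real" where
  "circle_mean u r = integral {0..2 * pi} (\<lambda>\<theta>. u (of_real r * cis \<theta>)) / (2 * pi)"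

end

theory Submission
  imports Defs
begin

text \<open>
  On \<open>1 \<le> |z| \<le> 2\<close> the function \<open>u - c\<close> is bounded in absolute value by a constant plus a radial
  function \<open>\<phi>(|z|)\<close> with \<open>\<integral> exp (2\<phi>) \<le> 8\<close> over \<open>[1,2]\<close>. Indeed \<open>u(a)\<close> differs from the mean of \<open>u\<close> over
  a small circle about \<open>a\<close> by at most a logarithmic potential of \<open>|\<Delta>u|\<close>, and
  \<open>|z - a| \<ge> ||z| - |a||\<close> bounds this by a one-dimensional logarithmic potential, which is
  exponentially integrable by Jensen's inequality when the mass of \<open>\<Delta>u\<close> is small. The means over
  the small circles are compared with \<open>c\<close> by a Poincare inequality, since the weak-\<open>L\<^sup>2\<close> bound
  controls \<open>\<nabla>u\<close> in \<open>L\<^sup>1\<close>. Because \<open>\<phi>\<close> is radial, both distance bounds reduce to integrals of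
  \<open>exp (\<plusminus>\<phi>)\<close> over \<open>[1,2]\<close>: from above along a spiral, from below by projecting a path to its
  radius.
\<close>

subsection \<open>Polar coordinates\<close>

text \<open>Small total curvature does not bound \<open>u\<close> uniformly: the logarithmic
  potential of a concentrated mass has arbitrarily high peaks. Exponential integrability over the
  plane would control the area but says nothing about a single path, which is a null set. The radial
  majorant is larger than the potential, yet costs only smallness of the mass: exp (m ln (1/|x|)) is
  |x| to the power -m, integrable on the line near 0 for m < 1. This fixes the thresholds. If the
  integral of |\<Delta>u| is below 1/2, the one-dimensional density has mass at most 1/8 after
  division by 2 pi. A further 1/8 is added to bound its mass in every window from below. Total mass
  1/4 brings exp (2\<phi>) down to averages of |2x| to the power -1/2, whose integral over |x| \<le>
  1/2 is 2. So the curvature threshold 1/2 serves every \<Lambda>, and \<Lambda> enters only the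
  final constants. The lower bounds come from the same estimate: by convexity an upper bound for the
  integral of exp (2\<phi>) is also a lower bound for integrals of exp (-\<phi>) and exp
  (-2\<phi>).\<close>

lemma borel_measurable_Complex [measurable (raw)]:
  assumes [measurable]: "f \<in> borel_measurable M" "g \<in> borel_measurable M"
  shows "(\<lambda>x. Complex (f x) (g x)) \<in> borel_measurable M"
  unfolding Complex_eq by measurable

text \<open>Both measures give a box the product of its side lengths, and boxes determine Lebesgue
  measure. This carries Fubini's theorem from \<open>real \<times> real\<close> over to
  \<open>complex\<close>.\<close>

lemma lborel_complex_eq_distr:
  "distr (lborel :: (real \<times> real) measure) borel (\<lambda>p. Complex (fst p) (snd p)) = lborel"
proof (rule lborel_eqI[symmetric])
  have m: "(\<lambda>p::real\<times>real. Complex (fst p) (snd p)) \<in> borel_measurable borel"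
    by (intro borel_measurable_continuous_onI) (auto simp: Complex_eq intro!: continuous_intros)
  fix l u :: complex
  assume le: "\<And>b. b \<in> Basis \<Longrightarrow> l \<bullet> b \<le> u \<bullet> b"
  have le': "Re l \<le> Re u" "Im l \<le> Im u"
    using le[of 1] le[of \<i>] by (auto simp: Basis_complex_def)
  have "(\<lambda>p::real\<times>real. Complex (fst p) (snd p)) -` box l u
      = box (Re l, Im l) (Re u, Im u)"
    by (auto simp: box_def Basis_complex_def Basis_prod_def)
  then show "emeasure (distr lborel borel (\<lambda>p::real\<times>real. Complex (fst p) (snd p))) (box l u)
      = ennreal (prod ((\<bullet>) (u - l)) Basis)"
    using m le' by (subst emeasure_distr)
      (auto simp: emeasure_lborel_box_eq Basis_complex_def Basis_prod_def complex_eq_iff prod.union_disjoint)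
qed simp

lemma nn_integral_complex_iterated:
  fixes f :: "complex \<Rightarrow> ennreal"
  assumes [measurable]: "f \<in> borel_measurable borel"
  shows "(\<integral>\<^sup>+z. f z \<partial>lborel) = (\<integral>\<^sup>+y. \<integral>\<^sup>+x. f (Complex x y) \<partial>lborel \<partial>lborel)"
proof -
  have m[measurable]: "(\<lambda>p::real\<times>real. Complex (fst p) (snd p)) \<in> borel_measurable borel"
    by (intro borel_measurable_continuous_onI) (auto simp: Complex_eq intro!: continuous_intros)
  have "(\<integral>\<^sup>+z. f z \<partial>lborel) = (\<integral>\<^sup>+p. f (Complex (fst p) (snd p)) \<partial>(lborel \<Otimes>\<^sub>M lborel))"
    unfolding lborel_complex_eq_distr[symmetric] lborel_prod
    by (subst nn_integral_distr) auto
  also have "\<dots> = (\<integral>\<^sup>+y. \<integral>\<^sup>+x. f (Complex x y) \<partial>lborel \<partial>lborel)"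
    by (subst lborel_pair.nn_integral_snd[symmetric])
       (auto simp: lborel_prod split_beta)
  finally show ?thesis .
qed

text \<open>Substitution on the compact intervals [-n, n], then monotone convergence on both sides:
  the images under \<open>arctan\<close> exhaust the open interval.\<close>

lemma nn_integral_arctan_substitution:
  fixes f :: "real \<Rightarrow> ennreal"
  assumes [measurable]: "f \<in> borel_measurable borel"
  shows "(\<integral>\<^sup>+m. f (arctan m) * ennreal (inverse (1 + m\<^sup>2)) \<partial>lborel)
       = (\<integral>\<^sup>+t. f t * indicator {-pi/2<..<pi/2} t \<partial>lborel)"
proof -
  have [measurable]: "arctan \<in> borel_measurable borel"
    by (intro borel_measurable_continuous_onI continuous_intros)
  have eq: "(\<integral>\<^sup>+t. f t * indicator {arctan (- real n)..arctan (real n)} t \<partial>lborel)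
     = (\<integral>\<^sup>+m. f (arctan m) * ennreal (inverse (1 + m\<^sup>2)) * indicator {- real n..real n} m \<partial>lborel)" for n
  proof (cases "n = 0")
    case True
    then show ?thesis by (simp add: nn_integral_indicator_singleton)
  next
    case False
    have "1 + m\<^sup>2 \<noteq> 0" for m :: real by (simp add: add_nonneg_eq_0_iff)
    then show ?thesis using False
      by (intro nn_integral_substitution_aux)
        (auto intro!: derivative_eq_intros continuous_intros simp: field_simps)
  qed
  have inc1: "incseq (\<lambda>n t. f t * indicator {arctan (- real n)..arctan (real n)} t)"
  proof (intro incseq_SucI le_funI mult_left_mono)
    fix n t
    have "arctan (- real (Suc n)) \<le> arctan (- real n)" "arctan (real n) \<le> arctan (real (Suc n))"
      by (simp_all only: arctan_le_iff)
    then show "(indicator {arctan (- real n)..arctan (real n)} t :: ennreal)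
        \<le> indicator {arctan (- real (Suc n))..arctan (real (Suc n))} t"
      unfolding indicator_def by force
  qed simp
  have inc2: "incseq (\<lambda>n m. f (arctan m) * ennreal (inverse (1 + m\<^sup>2)) * indicator {- real n..real n} m)"
    by (intro incseq_SucI le_funI mult_left_mono) (auto split: split_indicator)
  have s1: "(SUP n. f t * indicator {arctan (- real n)..arctan (real n)} t)
      = f t * indicator {-pi/2<..<pi/2} t" for t
  proof (cases "t \<in> {-pi/2<..<pi/2}")
    case True
    obtain n :: nat where n: "\<bar>tan t\<bar> \<le> real n" using real_arch_simple by blast
    have "arctan (- real n) \<le> arctan (tan t)" "arctan (tan t) \<le> arctan (real n)"
      using n by (auto simp: arctan_le_iff)
    moreover have "arctan (tan t) = t" using True by (simp add: arctan_tan)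
    ultimately have "t \<in> {arctan (- real n)..arctan (real n)}" by simp
    then show ?thesis using True
      by (intro antisym SUP_least SUP_upper2[of n]) (simp_all add: indicator_def)
  next
    case False
    then have "t \<notin> {arctan (- real n)..arctan (real n)}" for n
      using arctan_lbound[of "- real n"] arctan_ubound[of "real n"] by auto
    then show ?thesis using False by simp
  qed
  have s2: "(SUP n. f (arctan m) * ennreal (inverse (1 + m\<^sup>2)) * indicator {- real n..real n} m)
      = f (arctan m) * ennreal (inverse (1 + m\<^sup>2))" for m
  proof -
    obtain n :: nat where n: "\<bar>m\<bar> \<le> real n" using real_arch_simple by blast
    then have "m \<in> {- real n..real n}" by auto
    then show ?thesis
      by (intro antisym SUP_least SUP_upper2[of n]) (simp_all add: indicator_def)
  qed
  have "(\<integral>\<^sup>+t. f t * indicator {-pi/2<..<pi/2} t \<partial>lborel)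
     = (SUP n. \<integral>\<^sup>+t. f t * indicator {arctan (- real n)..arctan (real n)} t \<partial>lborel)"
    by (subst nn_integral_monotone_convergence_SUP[OF inc1, symmetric]) (auto simp: s1)
  also have "\<dots> = (\<integral>\<^sup>+m. f (arctan m) * ennreal (inverse (1 + m\<^sup>2)) \<partial>lborel)"
    unfolding eq
    by (subst nn_integral_monotone_convergence_SUP[OF inc2, symmetric]) (auto simp: s2)
  finally show ?thesis by simp
qed

lemma cis_arctan_plus_half_pi:
  "cis (arctan m + pi/2) = Complex (- m / sqrt (1 + m\<^sup>2)) (1 / sqrt (1 + m\<^sup>2))"
  by (simp add: complex_eq_iff cos_add sin_add sin_arctan cos_arctan)

lemma borel_measurable_ray_integral [measurable]:
  fixes f :: "complex \<Rightarrow> ennreal"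
  assumes [measurable]: "f \<in> borel_measurable borel"
  shows "(\<lambda>t. \<integral>\<^sup>+r. f (of_real r * cis t) * ennreal r \<partial>lborel) \<in> borel_measurable borel"
proof -
  have [measurable]: "(\<lambda>p::real\<times>real. of_real (snd p) * cis (fst p)) \<in> borel \<Otimes>\<^sub>M borel \<rightarrow>\<^sub>M borel"
    unfolding borel_prod by (intro borel_measurable_continuous_onI continuous_intros)
  have "(\<lambda>p. f (of_real (snd p) * cis (fst p)) * ennreal (snd p)) \<in> borel_measurable (borel \<Otimes>\<^sub>M borel)"
    by measurable
  then show ?thesis
    by (intro lborel.borel_measurable_nn_integral) (simp add: split_beta')
qed

text \<open>Fubini in the variables \<open>y\<close> and \<open>m = - x / y = tan (t - pi/2)\<close>: only linear substitutions
  and the one-dimensional substitution \<open>arctan\<close> are needed.\<close>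
lemma nn_integral_polar_upper_half_plane:
  fixes f :: "complex \<Rightarrow> ennreal"
  assumes [measurable]: "f \<in> borel_measurable borel"
  shows "(\<integral>\<^sup>+z. f z * indicator {z. Im z > 0} z \<partial>lborel)
       = (\<integral>\<^sup>+t. (\<integral>\<^sup>+r. f (of_real r * cis t) * ennreal r \<partial>lborel) * indicator {0<..<pi} t \<partial>lborel)"
proof -
  define G where "G t = (\<integral>\<^sup>+r. f (of_real r * cis t) * ennreal r \<partial>lborel)" for t
  have [measurable]: "G \<in> borel_measurable borel"
    unfolding G_def by measurable
  \<comment> \<open>At fixed height the substitution x = - m y is linear with Jacobian y. For y
    \<le> 0 both sides vanish, because \<open>ennreal y\<close> is then 0.\<close>
  have y: "(\<integral>\<^sup>+x. f (Complex x y) * indicator {z. Im z > 0} (Complex x y) \<partial>lborel)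
      = (\<integral>\<^sup>+m. f (Complex (- m * y) y) * ennreal y \<partial>lborel)" for y
  proof (cases "y > 0")
    case True
    have eq: "0 + - y * m = - m * y" for m by simp
    have "(\<integral>\<^sup>+x. f (Complex x y) * indicator {z. Im z > 0} (Complex x y) \<partial>lborel)
        = (\<integral>\<^sup>+x. f (Complex x y) \<partial>lborel)"
      using True by simp
    also have "\<dots> = ennreal \<bar>- y\<bar> * (\<integral>\<^sup>+m. f (Complex (0 + - y * m) y) \<partial>lborel)"
      using True by (intro nn_integral_real_affine) auto
    also have "\<dots> = ennreal y * (\<integral>\<^sup>+m. f (Complex (- m * y) y) \<partial>lborel)"
      using True unfolding eq by simp
    also have "\<dots> = (\<integral>\<^sup>+m. ennreal y * f (Complex (- m * y) y) \<partial>lborel)"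
      by (rule nn_integral_cmult[symmetric]) simp
    also have "\<dots> = (\<integral>\<^sup>+m. f (Complex (- m * y) y) * ennreal y \<partial>lborel)"
      by (intro nn_integral_cong mult.commute)
    finally show ?thesis .
  qed (auto simp: ennreal_neg)
  \<comment> \<open>At fixed slope the radius is r = k y, so y dy = r dr / k^2, and 1 / k^2 = 1 / (1
    + m^2) is exactly the density that the \<open>arctan\<close> substitution absorbs.\<close>
  have m: "(\<integral>\<^sup>+y. f (Complex (- m * y) y) * ennreal y \<partial>lborel)
      = G (arctan m + pi/2) * ennreal (inverse (1 + m\<^sup>2))" for m
  proof -
    define k where "k = sqrt (1 + m\<^sup>2)"
    have k: "k > 0" "k * k = 1 + m\<^sup>2" by (auto simp: k_def add_pos_nonneg)
    have "(\<integral>\<^sup>+y. f (Complex (- m * y) y) * ennreal y \<partial>lborel)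
       = ennreal (1/k) * (\<integral>\<^sup>+r. f (Complex (- m * (r/k)) (r/k)) * ennreal (r/k) \<partial>lborel)"
      using k by (subst nn_integral_real_affine[where c="1/k" and t=0]) auto
    also have "\<dots> = (\<integral>\<^sup>+r. (f (of_real r * cis (arctan m + pi/2)) * ennreal r) * ennreal (1/(k*k)) \<partial>lborel)"
    proof (subst nn_integral_cmult[symmetric], simp, intro nn_integral_cong)
      fix r
      have "of_real r * cis (arctan m + pi/2) = Complex (- m * (r/k)) (r/k)"
        unfolding cis_arctan_plus_half_pi k_def[symmetric] by (simp add: complex_eq_iff)
      then have "ennreal (1/k) * (f (Complex (- m * (r/k)) (r/k)) * ennreal (r/k))
          = f (of_real r * cis (arctan m + pi/2)) * (ennreal (1/k) * ennreal (r/k))"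
        by (simp only: mult.left_commute)
      also have "ennreal (1/k) * ennreal (r/k) = ennreal r * ennreal (1/(k*k))"
        using k by (simp add: ennreal_mult'[symmetric] ennreal_mult''[symmetric])
      finally show "ennreal (1/k) * (f (Complex (- m * (r/k)) (r/k)) * ennreal (r/k))
         = f (of_real r * cis (arctan m + pi/2)) * ennreal r * ennreal (1/(k*k))"
        by (simp only: mult.assoc)
    qed
    also have "\<dots> = G (arctan m + pi/2) * ennreal (1/(k*k))"
      unfolding G_def by (rule nn_integral_multc) simp
    finally show ?thesis by (simp only: k(2) inverse_eq_divide)
  qed
  have "(\<integral>\<^sup>+z. f z * indicator {z. Im z > 0} z \<partial>lborel)
     = (\<integral>\<^sup>+y. \<integral>\<^sup>+m. f (Complex (- m * y) y) * ennreal y \<partial>lborel \<partial>lborel)"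
    unfolding y[symmetric] by (rule nn_integral_complex_iterated) measurable
  also have "\<dots> = (\<integral>\<^sup>+m. \<integral>\<^sup>+y. f (Complex (- m * y) y) * ennreal y \<partial>lborel \<partial>lborel)"
    by (rule lborel_pair.Fubini') measurable
  also have "\<dots> = (\<integral>\<^sup>+t. G (t + pi/2) * indicator {-pi/2<..<pi/2} t \<partial>lborel)"
    unfolding m by (rule nn_integral_arctan_substitution[of "\<lambda>t. G (t + pi/2)"]) simp
  also have "\<dots> = (\<integral>\<^sup>+t. G t * indicator {0<..<pi} t \<partial>lborel)"
    by (subst (2) nn_integral_real_affine[where c=1 and t="pi/2"])
      (auto intro!: nn_integral_cong simp: indicator_def add.commute)
  finally show ?thesis unfolding G_def .
qed


lemma nn_integral_complex_uminus:
  fixes f :: "complex \<Rightarrow> ennreal"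
  assumes [measurable]: "f \<in> borel_measurable borel"
  shows "(\<integral>\<^sup>+z. f (- z) \<partial>lborel) = (\<integral>\<^sup>+z. f z \<partial>lborel)"
  by (subst (2) lborel_affine[of "-1" 0]) (auto simp: nn_integral_density nn_integral_distr)

lemma nn_integral_complex_translate:
  fixes f :: "complex \<Rightarrow> ennreal"
  assumes [measurable]: "f \<in> borel_measurable borel"
  shows "(\<integral>\<^sup>+z. f (a + z) \<partial>lborel) = (\<integral>\<^sup>+z. f z \<partial>lborel)"
  by (subst (2) lborel_distr_plus[of a, symmetric]) (simp add: nn_integral_distr)

lemma AE_lborel_Im_neq_0: "AE z in lborel. Im z \<noteq> 0"
proof -
  have [measurable]: "{z. Im z = 0} \<in> sets borel"
    by (intro borel_closed closed_Collect_eq continuous_intros)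
  have "emeasure lborel {z. Im z = 0} = (\<integral>\<^sup>+z. indicator {z. Im z = 0} z \<partial>lborel)"
    by simp
  also have "\<dots> = (\<integral>\<^sup>+y. \<infinity> * indicator {0::real} y \<partial>lborel)"
    by (subst nn_integral_complex_iterated) (auto intro!: nn_integral_cong simp: indicator_def mult.commute)
  also have "\<dots> = 0"
    by (simp add: nn_integral_indicator_singleton)
  finally show ?thesis by (intro AE_I[of _ _ "{z. Im z = 0}"]) auto
qed

lemma borel_measurable_polar [measurable]:
  "(\<lambda>p::real\<times>real. of_real (fst p) * cis (snd p)) \<in> borel \<Otimes>\<^sub>M borel \<rightarrow>\<^sub>M borel"
  unfolding borel_prod by (intro borel_measurable_continuous_onI continuous_intros)

text \<open>The real axis is null, and z -> -z maps the lower half-plane to the upper one, which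
  amounts to the shift of t by pi. The outer integral runs over all reals since
  \<open>ennreal r\<close> vanishes for negative r.\<close>

theorem nn_integral_polar:
  fixes f :: "complex \<Rightarrow> ennreal"
  assumes [measurable]: "f \<in> borel_measurable borel"
  shows "(\<integral>\<^sup>+z. f z \<partial>lborel)
       = (\<integral>\<^sup>+r. ennreal r * (\<integral>\<^sup>+t\<in>{0..2*pi}. f (a + of_real r * cis t) \<partial>lborel) \<partial>lborel)"
proof -
  define F where "F z = f (a + z)" for z
  have [measurable]: "F \<in> borel_measurable borel" unfolding F_def by measurable
  define H where "H t = (\<integral>\<^sup>+r. F (of_real r * cis t) * ennreal r \<partial>lborel)" for t
  have [measurable]: "H \<in> borel_measurable borel" unfolding H_def by measurable
  have [measurable]: "{z. 0 < Im z} \<in> sets borel" "{z. 0 > Im z} \<in> sets borel"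
    by (auto intro!: borel_open open_Collect_less continuous_intros)
  have "(\<integral>\<^sup>+z. f z \<partial>lborel) = (\<integral>\<^sup>+z. F z \<partial>lborel)"
    unfolding F_def by (rule nn_integral_complex_translate[symmetric]) simp
  also have "\<dots> = (\<integral>\<^sup>+z. F z * indicator {z. Im z > 0} z + F z * indicator {z. Im z < 0} z \<partial>lborel)"
    by (rule nn_integral_cong_AE, rule AE_mp[OF AE_lborel_Im_neq_0])
      (auto simp: indicator_def)
  also have "\<dots> = (\<integral>\<^sup>+z. F z * indicator {z. Im z > 0} z \<partial>lborel)
      + (\<integral>\<^sup>+z. F z * indicator {z. Im z < 0} z \<partial>lborel)"
    by (intro nn_integral_add) auto
  also have "(\<integral>\<^sup>+z. F z * indicator {z. Im z < 0} z \<partial>lborel)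
      = (\<integral>\<^sup>+z. F (- z) * indicator {z. Im z > 0} z \<partial>lborel)"
    by (subst nn_integral_complex_uminus[symmetric]) (auto simp: indicator_def)
  also have "\<dots> = (\<integral>\<^sup>+t. H (t + pi) * indicator {0<..<pi} t \<partial>lborel)"
    unfolding H_def by (subst nn_integral_polar_upper_half_plane) (auto simp: cis_mult[symmetric])
  also have "\<dots> = (\<integral>\<^sup>+t. H t * indicator {pi<..<2*pi} t \<partial>lborel)"
    by (subst (2) nn_integral_real_affine[where c=1 and t=pi])
      (auto intro!: nn_integral_cong simp: indicator_def add.commute)
  also have "(\<integral>\<^sup>+z. F z * indicator {z. Im z > 0} z \<partial>lborel)
      = (\<integral>\<^sup>+t. H t * indicator {0<..<pi} t \<partial>lborel)"
    unfolding H_def by (rule nn_integral_polar_upper_half_plane) simp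
  also have "(\<integral>\<^sup>+t. H t * indicator {0<..<pi} t \<partial>lborel) + (\<integral>\<^sup>+t. H t * indicator {pi<..<2*pi} t \<partial>lborel)
      = (\<integral>\<^sup>+t. H t * indicator {0<..<pi} t + H t * indicator {pi<..<2*pi} t \<partial>lborel)"
    by (intro nn_integral_add[symmetric]) auto
  also have "\<dots> = (\<integral>\<^sup>+t. H t * indicator {0..2*pi} t \<partial>lborel)"
  proof (rule nn_integral_cong_AE)
    have "AE t in lborel. t \<notin> {0,pi,2*pi}"
      by (intro AE_not_in finite_imp_null_set_lborel) auto
    then show "AE t in lborel. H t * indicator {0<..<pi} t + H t * indicator {pi<..<2*pi} t
        = H t * indicator {0..2*pi} t"
      by eventually_elim (use pi_gt_zero in \<open>auto simp: indicator_def\<close>)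
  qed
  also have "\<dots> = (\<integral>\<^sup>+t. (\<integral>\<^sup>+r. ennreal r * (F (of_real r * cis t) * indicator {0..2*pi} t) \<partial>lborel) \<partial>lborel)"
    unfolding H_def
    by (subst nn_integral_multc[symmetric]) (auto simp: mult_ac)
  also have "\<dots> = (\<integral>\<^sup>+r. (\<integral>\<^sup>+t. ennreal r * (F (of_real r * cis t) * indicator {0..2*pi} t) \<partial>lborel) \<partial>lborel)"
  proof -
    have "(\<lambda>p. ennreal (fst p) * (F (of_real (fst p) * cis (snd p)) * indicator {0..2*pi} (snd p)))
        \<in> borel_measurable (lborel \<Otimes>\<^sub>M lborel)"
      by measurable
    then show ?thesis
      by (intro lborel_pair.Fubini') (simp add: split_beta')
  qed
  also have "\<dots> = (\<integral>\<^sup>+r. ennreal r * (\<integral>\<^sup>+t\<in>{0..2*pi}. F (of_real r * cis t) \<partial>lborel) \<partial>lborel)"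
  proof (rule nn_integral_cong)
    fix r
    have [measurable]: "(\<lambda>t. of_real r * cis t) \<in> borel_measurable borel"
      by (intro borel_measurable_continuous_onI continuous_intros)
    show "(\<integral>\<^sup>+t. ennreal r * (F (of_real r * cis t) * indicator {0..2*pi} t) \<partial>lborel)
        = ennreal r * (\<integral>\<^sup>+t\<in>{0..2*pi}. F (of_real r * cis t) \<partial>lborel)"
      by (rule nn_integral_cmult) simp
  qed
  finally show ?thesis unfolding F_def .
qed

subsection \<open>Circle integrals of smooth functions\<close>

lemma smooth_on_subset: "smooth_on A f \<Longrightarrow> B \<subseteq> A \<Longrightarrow> smooth_on B f"
  unfolding smooth_on_def by blast

lemma smooth_on_dx: "smooth_on A f \<Longrightarrow> smooth_on A (dx f)"
  and smooth_on_dy: "smooth_on A f \<Longrightarrow> smooth_on A (dy f)"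
  unfolding smooth_on_def dx_def[abs_def] dy_def[abs_def] by (metis C_k_on.simps(2))+

lemma smooth_on_imp_differentiable:
  assumes "smooth_on A f" "z \<in> A"
  shows "f differentiable (at z)"
proof -
  obtain U where U: "open U" "A \<subseteq> U" "C_k_on (Suc 0) f U"
    using assms unfolding smooth_on_def by blast
  then show ?thesis
    using assms(2) by (metis C_k_on.simps(2) at_within_open differentiable_on_def subsetD)
qed

lemma smooth_on_imp_continuous_on: "smooth_on A f \<Longrightarrow> continuous_on A f"
  by (meson continuous_at_imp_continuous_on differentiable_imp_continuous_within smooth_on_imp_differentiable)

lemma smooth_on_has_derivative:
  assumes "smooth_on A f" "z \<in> A"
  shows "(f has_derivative (\<lambda>v. dx f z * Re v + dy f z * Im v)) (at z within S)"
proof -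
  let ?D = "frechet_derivative f (at z)"
  have D: "(f has_derivative ?D) (at z)"
    using smooth_on_imp_differentiable[OF assms] frechet_derivative_works by blast
  then interpret linear ?D by (rule has_derivative_linear)
  have "?D = (\<lambda>v. dx f z * Re v + dy f z * Im v)"
  proof
    fix v
    have "v = Re v *\<^sub>R 1 + Im v *\<^sub>R \<i>" by (simp add: complex_eq_iff)
    then have "?D v = Re v *\<^sub>R ?D 1 + Im v *\<^sub>R ?D \<i>" by (metis add scaleR)
    then show "?D v = dx f z * Re v + dy f z * Im v" by (simp add: dx_def dy_def)
  qed
  then show ?thesis using has_derivative_at_withinI[OF D] by simp
qed

lemma continuous_on_laplacian: "smooth_on A u \<Longrightarrow> continuous_on A (laplacian u)"
  unfolding laplacian_def[abs_def]
  by (intro continuous_intros smooth_on_imp_continuous_on smooth_on_dx smooth_on_dy)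

lemma continuous_on_grad: "smooth_on A u \<Longrightarrow> continuous_on A (grad u)"
  unfolding grad_def[abs_def] Complex_eq
  by (intro continuous_intros smooth_on_imp_continuous_on smooth_on_dx smooth_on_dy)

lemma smooth_on_radial_derivative:
  assumes "smooth_on A u" "a + of_real r * cis t \<in> A"
  shows "((\<lambda>r. u (a + of_real r * cis t)) has_real_derivative
     dx u (a + of_real r * cis t) * cos t + dy u (a + of_real r * cis t) * sin t) (at r within S)"
proof -
  have "((\<lambda>r. a + of_real r * cis t) has_derivative (\<lambda>h. of_real h * cis t)) (at r within S)"
    by (auto intro!: derivative_eq_intros)
  from has_derivative_compose[OF this smooth_on_has_derivative[OF assms]]
  show ?thesis
    unfolding has_field_derivative_def by (rule has_derivative_eq_rhs) (auto simp: fun_eq_iff algebra_simps)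
qed

lemma smooth_on_angular_derivative:
  assumes "smooth_on A u" "a + of_real r * cis t \<in> A"
  shows "((\<lambda>t. u (a + of_real r * cis t)) has_real_derivative
     r * (dy u (a + of_real r * cis t) * cos t - dx u (a + of_real r * cis t) * sin t)) (at t within S)"
proof -
  have "((\<lambda>t. a + of_real r * Complex (cos t) (sin t)) has_derivative
     (\<lambda>h. of_real r * (of_real h * Complex (- sin t) (cos t)))) (at t within S)"
    unfolding Complex_eq by (auto intro!: derivative_eq_intros simp: algebra_simps)
  then have "((\<lambda>t. a + of_real r * cis t) has_derivative
     (\<lambda>h. of_real r * (of_real h * Complex (- sin t) (cos t)))) (at t within S)"
    by (simp add: cis.code)
  from has_derivative_compose[OF this smooth_on_has_derivative[OF assms]]
  show ?thesis
    unfolding has_field_derivative_def by (rule has_derivative_eq_rhs) (auto simp: fun_eq_iff algebra_simps)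
qed

lemma continuous_on_polar:
  assumes "continuous_on {z. r0 \<le> norm (z - a) \<and> norm (z - a) \<le> r1} f" "0 \<le> r0" 
  shows "continuous_on ({r0..r1} \<times> {\<alpha>..\<beta>}) (\<lambda>(r, t). f (a + of_real r * cis t))"
  unfolding split_beta'
  by (rule continuous_on_compose2[OF assms(1)])
    (use assms(2) in \<open>auto intro!: continuous_intros simp: norm_mult\<close>)

lemma continuous_on_circle:
  assumes "continuous_on {z. r0 \<le> norm (z - a) \<and> norm (z - a) \<le> r1} f" "0 \<le> r0" "r \<in> {r0..r1}"
  shows "continuous_on S (\<lambda>t. f (a + of_real r * cis t))"
  by (rule continuous_on_compose2[OF assms(1)])
    (use assms in \<open>auto intro!: continuous_intros simp: norm_mult\<close>)

text \<open>The case \<open>r0 = 0\<close> is included: the map (r, t) -> a + r cis t is smooth at r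
  = 0 although it is not a chart there. Thus annuli and full discs are treated together.\<close>

lemma circle_integral_derivative:
  assumes u: "smooth_on {z. r0 \<le> norm (z - a) \<and> norm (z - a) \<le> r1} u" and r: "0 \<le> r0" "r \<in> {r0..r1}"
  shows "((\<lambda>r. integral {0..2*pi} (\<lambda>t. u (a + of_real r * cis t))) has_real_derivative
     integral {0..2*pi} (\<lambda>t. dx u (a + of_real r * cis t) * cos t + dy u (a + of_real r * cis t) * sin t))
     (at r within {r0..r1})"
proof -
  note c = continuous_on_polar[OF smooth_on_imp_continuous_on \<open>0 \<le> r0\<close>, unfolded split_beta', where \<alpha>=0 and \<beta>="2*pi"]
  have "((\<lambda>r. integral (cbox 0 (2*pi)) (\<lambda>t. u (a + of_real r * cis t))) has_real_derivative
     integral (cbox 0 (2*pi)) (\<lambda>t. dx u (a + of_real r * cis t) * cos t + dy u (a + of_real r * cis t) * sin t))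
     (at r within {r0..r1})"
  proof (rule leibniz_rule_field_derivative)
    show "continuous_on ({r0..r1} \<times> cbox 0 (2*pi))
       (\<lambda>(r, t). dx u (a + of_real r * cis t) * cos t + dy u (a + of_real r * cis t) * sin t)"
      unfolding split_beta' box_real
      by (intro continuous_intros c smooth_on_dx smooth_on_dy u)
    fix s t assume s: "s \<in> {r0..r1}"
    then show "(\<lambda>t. u (a + of_real s * cis t)) integrable_on cbox 0 (2 * pi)"
      by (intro integrable_continuous continuous_on_circle[OF smooth_on_imp_continuous_on[OF u] \<open>0 \<le> r0\<close>])
    show "((\<lambda>r. u (a + of_real r * cis t)) has_real_derivative
     dx u (a + of_real s * cis t) * cos t + dy u (a + of_real s * cis t) * sin t) (at s within {r0..r1})"
      by (rule smooth_on_radial_derivative[OF u]) (use s r in \<open>simp add: norm_mult\<close>)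
  qed (use r in auto)
  then show ?thesis by simp
qed

text \<open>The divergence theorem in differentiated form. In polar coordinates r \<Delta>u is the
  sum of the r-derivative of r u_r and the t-derivative of u_t / r; in the proof \<open>f\<close> is
  r u_r and \<open>w\<close> is u_t / r.\<close>

lemma circle_flux_derivative:
  assumes u: "smooth_on {z. r0 \<le> norm (z - a) \<and> norm (z - a) \<le> r1} u" and r: "0 \<le> r0" "r \<in> {r0..r1}"
  shows "((\<lambda>r. r * integral {0..2*pi} (\<lambda>t. dx u (a + of_real r * cis t) * cos t + dy u (a + of_real r * cis t) * sin t))
     has_real_derivative r * integral {0..2*pi} (\<lambda>t. laplacian u (a + of_real r * cis t))) (at r within {r0..r1})"
proof -
  let ?A = "{z. r0 \<le> norm (z - a) \<and> norm (z - a) \<le> r1}"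
  let ?z = "\<lambda>r t. a + complex_of_real r * cis t"
  define f where "f r t = r * (dx u (?z r t) * cos t + dy u (?z r t) * sin t)" for r t
  define f' where "f' r t = (dx u (?z r t) * cos t + dy u (?z r t) * sin t)
     + r * ((dx (dx u) (?z r t) * cos t + dy (dx u) (?z r t) * sin t) * cos t
          + (dx (dy u) (?z r t) * cos t + dy (dy u) (?z r t) * sin t) * sin t)" for r t
  define w where "w t = dy u (?z r t) * cos t - dx u (?z r t) * sin t" for t
  define w' where "w' t = r * (dy (dy u) (?z r t) * cos t - dx (dy u) (?z r t) * sin t) * cos t - dy u (?z r t) * sin t
     - (r * (dy (dx u) (?z r t) * cos t - dx (dx u) (?z r t) * sin t) * sin t + dx u (?z r t) * cos t)" for t
  note sm = smooth_on_dx smooth_on_dy u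
  note c = continuous_on_polar[OF smooth_on_imp_continuous_on \<open>0 \<le> r0\<close>, unfolded split_beta', where \<alpha>=0 and \<beta>="2*pi"]
  note cc = continuous_on_circle[OF smooth_on_imp_continuous_on \<open>0 \<le> r0\<close>, where ?r1.0=r1]
  have "((\<lambda>r. integral (cbox 0 (2*pi)) (f r)) has_real_derivative integral (cbox 0 (2*pi)) (f' r)) (at r within {r0..r1})"
  proof (rule leibniz_rule_field_derivative)
    show "continuous_on ({r0..r1} \<times> cbox 0 (2*pi)) (\<lambda>(r, t). f' r t)"
      unfolding split_beta' box_real f'_def by (intro continuous_intros c sm)
    fix s t assume s: "s \<in> {r0..r1}"
    then show "f s integrable_on cbox 0 (2 * pi)"
      unfolding f_def[abs_def] by (intro integrable_continuous continuous_intros cc sm) (simp_all add: u)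
    have "?z s t \<in> ?A" using s r by (simp add: norm_mult)
    note [derivative_intros] = smooth_on_radial_derivative[OF _ this]
    show "((\<lambda>r. f r t) has_real_derivative f' s t) (at s within {r0..r1})"
      unfolding f_def f'_def by (rule derivative_eq_intros sm refl | simp add: algebra_simps)+
  qed (use r in auto)
  then have 1: "((\<lambda>r. integral {0..2*pi} (f r)) has_real_derivative integral {0..2*pi} (f' r)) (at r within {r0..r1})"
    by simp
  have "(w' has_integral (w (2*pi) - w 0)) {0..2*pi}"
  proof (rule fundamental_theorem_of_calculus)
    fix t
    have "?z r t \<in> ?A" using r by (simp add: norm_mult)
    note [derivative_intros] = smooth_on_angular_derivative[OF _ this]
    have "(w has_real_derivative w' t) (at t within {0..2*pi})"
      unfolding w_def[abs_def] w'_def by (rule derivative_eq_intros sm refl | simp add: algebra_simps)+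
    then show "(w has_vector_derivative w' t) (at t within {0..2*pi})"
      by (simp add: has_real_derivative_iff_has_vector_derivative)
  qed simp
  moreover have "w (2*pi) = w 0" by (simp add: w_def cis_2pi)
  ultimately have w': "(w' has_integral 0) {0..2*pi}" by simp
  \<comment> \<open>The tangential part of the Laplacian is the derivative of the periodic function \<open>w\<close>,
    so it integrates to zero.\<close>
  have L: "f' r t = r * laplacian u (?z r t) - w' t" for t
  proof -
    have "f' r t + w' t = r * (dx (dx u) (?z r t) * ((cos t)\<^sup>2 + (sin t)\<^sup>2)
        + dy (dy u) (?z r t) * ((cos t)\<^sup>2 + (sin t)\<^sup>2))"
      unfolding f'_def w'_def by (simp add: algebra_simps power2_eq_square del: sin_cos_squared_add sin_cos_squared_add2 sin_cos_squared_add3)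
    then show ?thesis by (simp add: laplacian_def)
  qed
  have "(\<lambda>t. r * laplacian u (?z r t)) integrable_on {0..2*pi}"
    unfolding laplacian_def by (intro integrable_continuous_interval continuous_intros cc sm r)
  from integral_diff[OF this has_integral_integrable[OF w']]
  have "integral {0..2*pi} (f' r) = r * integral {0..2*pi} (\<lambda>t. laplacian u (?z r t))"
    unfolding L[abs_def] using integral_unique[OF w'] by simp
  with 1 show ?thesis unfolding f_def[abs_def] by simp
qed

section \<open>Lebesgue integrals over annuli in polar coordinates\<close>

lemma ennreal_integral_Icc:
  fixes f :: "real \<Rightarrow> real"
  assumes "continuous_on {a..b} f" "\<And>x. x \<in> {a..b} \<Longrightarrow> 0 \<le> f x"
  shows "(\<integral>\<^sup>+x\<in>{a..b}. ennreal (f x) \<partial>lborel) = ennreal (integral {a..b} f)"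
  using assms by (intro nn_integral_has_integral_lebesgue' integrable_integral integrable_continuous_interval)

lemma borel_measurable_ennreal_on_indicator:
  fixes f :: "'a::topological_space \<Rightarrow> real"
  assumes "continuous_on A f" "A \<in> sets borel"
  shows "(\<lambda>x. ennreal (f x) * indicator A x) \<in> borel_measurable borel"
proof -
  have "(\<lambda>x. ennreal (indicator A x *\<^sub>R f x)) \<in> borel_measurable borel"
    using borel_measurable_continuous_on_indicator[OF assms(2,1)] by measurable
  moreover have "ennreal (indicator A x *\<^sub>R f x) = ennreal (f x) * indicator A x" for x
    by (simp add: indicator_def)
  ultimately show ?thesis by simp
qed

text \<open>The radial weight \<open>k\<close> is kept apart from \<open>g\<close> and only required
  to be Borel, since it will be a logarithm with a singularity; \<open>g\<close> is continuous, so
  its circle integrals are ordinary ones.\<close>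

lemma nn_integral_polar_annulus:
  fixes g :: "complex \<Rightarrow> real" and k :: "real \<Rightarrow> real"
  assumes g: "continuous_on {z. r0 \<le> norm (z - a) \<and> norm (z - a) \<le> r1} g" "\<And>z. 0 \<le> g z"
    and k[measurable]: "k \<in> borel_measurable borel" and k0: "\<And>r. 0 \<le> k r" and r0: "0 \<le> r0"
  shows "(\<integral>\<^sup>+z\<in>{z. r0 \<le> norm (z - a) \<and> norm (z - a) \<le> r1}. ennreal (k (norm (z - a)) * g z) \<partial>lborel)
    = (\<integral>\<^sup>+r\<in>{r0..r1}. ennreal (k r * (r * integral {0..2*pi} (\<lambda>t. g (a + of_real r * cis t)))) \<partial>lborel)"
proof -
  let ?A = "{z. r0 \<le> norm (z - a) \<and> norm (z - a) \<le> r1}"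
  have A: "?A \<in> sets borel" 
    by (intro borel_closed closed_Collect_conj closed_Collect_le continuous_intros)
  note [measurable] = borel_measurable_ennreal_on_indicator[OF g(1) A]
  have "(\<integral>\<^sup>+z\<in>?A. ennreal (k (norm (z - a)) * g z) \<partial>lborel)
     = (\<integral>\<^sup>+z. ennreal (k (norm (z - a))) * (ennreal (g z) * indicator ?A z) \<partial>lborel)"
    using k0 g(2) by (intro nn_integral_cong) (simp add: ennreal_mult mult.assoc)
  also have "\<dots> = (\<integral>\<^sup>+r. ennreal r * (\<integral>\<^sup>+t\<in>{0..2*pi}. ennreal (k (norm (of_real r * cis t)))
       * (ennreal (g (a + of_real r * cis t)) * indicator ?A (a + of_real r * cis t)) \<partial>lborel) \<partial>lborel)"
    by (subst nn_integral_polar[where a=a]) (simp_all only: add_diff_cancel_left', measurable)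
  also have "\<dots> = (\<integral>\<^sup>+r\<in>{r0..r1}. ennreal (k r * (r * integral {0..2*pi} (\<lambda>t. g (a + of_real r * cis t)))) \<partial>lborel)"
  proof (rule nn_integral_cong)
    fix r
    consider "r < 0" | "r \<ge> 0" "r \<notin> {r0..r1}" | "r \<ge> 0" "r \<in> {r0..r1}" by linarith
    then show "ennreal r * (\<integral>\<^sup>+t\<in>{0..2*pi}. ennreal (k (norm (of_real r * cis t)))
       * (ennreal (g (a + of_real r * cis t)) * indicator ?A (a + of_real r * cis t)) \<partial>lborel)
      = ennreal (k r * (r * integral {0..2*pi} (\<lambda>t. g (a + of_real r * cis t)))) * indicator {r0..r1} r"
    proof cases
      case 1 then show ?thesis using r0 by (simp add: ennreal_neg indicator_def)
    next
      case 2 then have "a + of_real r * cis t \<notin> ?A" for t by (simp add: norm_mult)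
      then show ?thesis using 2 by simp
    next
      case 3
      then have m: "a + of_real r * cis t \<in> ?A" for t by (simp add: norm_mult)
      have c: "continuous_on {0..2*pi} (\<lambda>t. g (a + of_real r * cis t))"
        using continuous_on_circle[OF g(1) r0] 3 by blast
      have "(\<integral>\<^sup>+t\<in>{0..2*pi}. ennreal (k (norm (of_real r * cis t)))
       * (ennreal (g (a + of_real r * cis t)) * indicator ?A (a + of_real r * cis t)) \<partial>lborel)
        = (\<integral>\<^sup>+t. ennreal (k r) * (ennreal (g (a + of_real r * cis t)) * indicator {0..2*pi} t) \<partial>lborel)"
        using 3 m by (intro nn_integral_cong) (simp add: norm_mult indicator_def)
      also have "\<dots> = ennreal (k r) * (\<integral>\<^sup>+t\<in>{0..2*pi}. ennreal (g (a + of_real r * cis t)) \<partial>lborel)"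
        using borel_measurable_ennreal_on_indicator[OF c]
        by (intro nn_integral_cmult) simp
      also have "(\<integral>\<^sup>+t\<in>{0..2*pi}. ennreal (g (a + of_real r * cis t)) \<partial>lborel)
          = ennreal (integral {0..2*pi} (\<lambda>t. g (a + of_real r * cis t)))"
        by (rule ennreal_integral_Icc[OF c g(2)])
      finally show ?thesis
        using 3 k0 g(2) by (simp add: ennreal_mult' mult.left_commute integral_nonneg c integrable_continuous_interval)
    qed
  qed
  finally show ?thesis .
qed

text \<open>Only s = 0 is critical, where the factor s makes the value 0. Applying ln x \<le> x to
  sqrt (R / s) gives s ln (R / s) \<le> 2 sqrt (R s), so the limit is 0 as well.\<close>

lemma continuous_on_mult_ln:
  fixes R :: real
  assumes "0 < R"
  shows "continuous_on {0..R} (\<lambda>s. ln (R / s) * s)"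
proof -
  have lim: "((\<lambda>s::real. ln (R / s) * s) \<longlongrightarrow> 0) (at 0 within {0..R})"
  proof (rule tendsto_sandwich[of "\<lambda>_. 0" _ _ "\<lambda>s. 2 * sqrt (R * s)"])
    show "\<forall>\<^sub>F s in at 0 within {0..R}. 0 \<le> ln (R / s) * s"
      using assms by (auto simp: eventually_at_filter intro!: always_eventually)
    show "\<forall>\<^sub>F s in at 0 within {0..R}. ln (R / s) * s \<le> 2 * sqrt (R * s)"
    proof (unfold eventually_at_filter, intro always_eventually allI impI)
      fix s :: real assume s: "s \<noteq> 0" "s \<in> {0..R}"
      then have "ln (R / s) = 2 * ln (sqrt (R / s))" using assms by (simp add: ln_sqrt)
      also have "\<dots> \<le> 2 * sqrt (R / s)" using s assms ln_bound[of "sqrt (R/s)"] by simp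
      finally have "ln (R / s) * s \<le> 2 * sqrt (R / s) * s" using s by (intro mult_right_mono) auto
      also have "2 * sqrt (R / s) * s = 2 * sqrt (R * s)"
        using s by (simp add: real_sqrt_divide real_sqrt_mult field_simps)
      finally show "ln (R / s) * s \<le> 2 * sqrt (R * s)" .
    qed
    show "((\<lambda>s. 2 * sqrt (R * s)) \<longlongrightarrow> 0) (at 0 within {0..R})"
      by (auto intro!: tendsto_eq_intros)
  qed simp
  show ?thesis
  proof (unfold continuous_on_eq_continuous_within, intro ballI)
    fix s assume "s \<in> {0..R}"
    then show "continuous (at s within {0..R}) (\<lambda>s. ln (R / s) * s)"
      using lim assms by (cases "s = 0") (auto simp: continuous_within intro!: tendsto_intros)
  qed
qed

subsection \<open>Mean value inequality and Poincare inequality\<close>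

lemma abs_integral_le_integral:
  fixes f g :: "'n::euclidean_space \<Rightarrow> real"
  assumes "f integrable_on S" "g integrable_on S" "\<And>x. x \<in> S \<Longrightarrow> \<bar>f x\<bar> \<le> g x"
  shows "\<bar>integral S f\<bar> \<le> integral S g"
  using Henstock_Kurzweil_Integration.integral_norm_bound_integral[of f S g] assms by simp

lemma continuous_on_circle_integral:
  fixes f :: "complex \<Rightarrow> real"
  assumes "continuous_on {z. r0 \<le> norm (z - a) \<and> norm (z - a) \<le> r1} f" "0 \<le> r0"
  shows "continuous_on {r0..r1} (\<lambda>r. integral {0..2*pi} (\<lambda>t. f (a + of_real r * cis t)))"
  using integral_continuous_on_param[of "{r0..r1}" 0 "2*pi" "\<lambda>r t. f (a + of_real r * cis t)"]
    continuous_on_polar[OF assms, of 0 "2*pi"]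
  by simp

text \<open>Green's representation at the centre of a disc, with Green function ln (R / |z - a|),
  reduced to a one-dimensional integration by parts of circle integrals. The boundary values are G R
  = M R, because ln 1 = 0, and G 0 = M 0 = 2 pi u(a).\<close>

lemma norm_circle_mean_diff_le:
  assumes u: "smooth_on (cball a R) u" and R: "0 < R"
  shows "ennreal \<bar>integral {0..2*pi} (\<lambda>t. u (a + of_real R * cis t)) - 2 * pi * u a\<bar>
    \<le> (\<integral>\<^sup>+z\<in>cball a R. ennreal (ln (R / norm (z - a)) * \<bar>laplacian u z\<bar>) \<partial>lborel)"
proof -
  let ?A = "{z. 0 \<le> norm (z - a) \<and> norm (z - a) \<le> R}"
  have A: "?A = cball a R" by (auto simp: dist_norm norm_minus_commute)
  note u' = u[folded A]
  define M where "M r = integral {0..2*pi} (\<lambda>t. u (a + of_real r * cis t))" for r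
  define D where "D r = integral {0..2*pi} (\<lambda>t. dx u (a + of_real r * cis t) * cos t + dy u (a + of_real r * cis t) * sin t)" for r
  define N where "N r = integral {0..2*pi} (\<lambda>t. laplacian u (a + of_real r * cis t))" for r
  define L where "L r = integral {0..2*pi} (\<lambda>t. \<bar>laplacian u (a + of_real r * cis t)\<bar>)" for r
  \<comment> \<open>Since \<open>M' = D\<close> and \<open>(s * D)' = s * N\<close>, the terms in \<open>D\<close> cancel in \<open>G'\<close>; at \<open>s = 0\<close> the junk
    value \<open>ln (R / 0) = 0\<close> agrees with the limit.\<close>
  define G where "G s = M s + ln (R / s) * s * D s" for s
  note c = continuous_on_polar[OF smooth_on_imp_continuous_on order_refl, unfolded split_beta', where \<alpha>=0 and \<beta>="2*pi"]
  have cM: "continuous_on {0..R} M"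
    unfolding M_def by (rule continuous_on_circle_integral[OF smooth_on_imp_continuous_on[OF u'] order_refl])
  have cD: "continuous_on {0..R} D"
  proof -
    have "continuous_on ({0..R} \<times> cbox 0 (2*pi))
        (\<lambda>(r, t). dx u (a + of_real r * cis t) * cos t + dy u (a + of_real r * cis t) * sin t)"
      unfolding split_beta' box_real by (intro continuous_intros c smooth_on_dx smooth_on_dy u')
    from integral_continuous_on_param[OF this] show ?thesis unfolding D_def by simp
  qed
  have cL: "continuous_on {0..R} L"
    unfolding L_def
    by (rule continuous_on_circle_integral[OF continuous_on_rabs[OF continuous_on_laplacian[OF u']] order_refl])
  have cln: "continuous_on {0..R} (\<lambda>s. ln (R / s) * s)" by (rule continuous_on_mult_ln[OF R])
  have G': "((\<lambda>s. ln (R / s) * (s * N s)) has_integral (G R - G 0)) {0..R}"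
  proof (rule fundamental_theorem_of_calculus_interior)
    show "continuous_on {0..R} G"
      unfolding G_def by (intro continuous_on_add continuous_on_mult cM cD cln)
    fix s assume s: "s \<in> {0<..<R}"
    have at: "at s within {0..R} = at s"
      using s by (intro at_within_interior) (simp add: interior_atLeastAtMost_real)
    have M': "(M has_real_derivative D s) (at s)"
      using circle_integral_derivative[OF u', of s] s unfolding at M_def D_def by simp
    have Q': "((\<lambda>s. s * D s) has_real_derivative s * N s) (at s)"
      using circle_flux_derivative[OF u', of s] s unfolding at N_def D_def by simp
    have ln': "((\<lambda>s. ln (R / s)) has_real_derivative - (1 / s)) (at s)"
      using s R by (auto intro!: derivative_eq_intros simp: field_simps power2_eq_square)
    have "((\<lambda>s. M s + ln (R / s) * (s * D s)) has_real_derivative ln (R / s) * (s * N s)) (at s)"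
      using DERIV_add[OF M' DERIV_mult[OF ln' Q']] s by (simp add: mult.commute)
    then show "(G has_vector_derivative ln (R / s) * (s * N s)) (at s)"
      unfolding G_def by (simp add: has_real_derivative_iff_has_vector_derivative mult.assoc)
  qed (use R in simp)
  have NL: "\<bar>N s\<bar> \<le> L s" if "s \<in> {0..R}" for s
    unfolding N_def L_def
    by (rule abs_integral_le_integral)
      (use that in \<open>auto intro!: integrable_continuous_interval continuous_on_circle[OF _ order_refl]
         continuous_on_rabs continuous_on_laplacian u'\<close>)
  have int: "(\<lambda>s. ln (R / s) * s * L s) integrable_on {0..R}"
    by (intro integrable_continuous_interval continuous_on_mult cln cL)
  have "\<bar>G R - G 0\<bar> = \<bar>integral {0..R} (\<lambda>s. ln (R / s) * (s * N s))\<bar>"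
    using integral_unique[OF G'] by simp
  also have "\<dots> \<le> integral {0..R} (\<lambda>s. ln (R / s) * s * L s)"
  proof (rule abs_integral_le_integral[OF has_integral_integrable[OF G'] int])
    fix s assume s: "s \<in> {0..R}"
    then have nn: "0 \<le> ln (R / s) * s" by (cases "s = 0") auto
    then have "\<bar>ln (R / s) * (s * N s)\<bar> = (ln (R / s) * s) * \<bar>N s\<bar>"
      by (metis abs_mult abs_of_nonneg mult.assoc)
    also have "\<dots> \<le> ln (R / s) * s * L s"
      using nn by (rule mult_left_mono[OF NL[OF s]])
    finally show "\<bar>ln (R / s) * (s * N s)\<bar> \<le> ln (R / s) * s * L s" .
  qed
  finally have "ennreal \<bar>G R - G 0\<bar> \<le> ennreal (integral {0..R} (\<lambda>s. ln (R / s) * s * L s))"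
    by (rule ennreal_leI)
  also have "\<dots> = (\<integral>\<^sup>+s\<in>{0..R}. ennreal (ln (R / s) * s * L s) \<partial>lborel)"
  proof (rule ennreal_integral_Icc[symmetric])
    show "continuous_on {0..R} (\<lambda>s. ln (R / s) * s * L s)" by (intro continuous_on_mult cln cL)
    fix s assume s: "s \<in> {0..R}"
    then have "0 \<le> ln (R / s) * s" by (cases "s = 0") auto
    moreover have "0 \<le> L s" using NL[OF s] by linarith
    ultimately show "0 \<le> ln (R / s) * s * L s" by (rule mult_nonneg_nonneg)
  qed
  \<comment> \<open>On [0, R] the maximum changes nothing; it makes the weight nonnegative for every
    radius, as the polar formula demands.\<close>
  also have "\<dots> = (\<integral>\<^sup>+s\<in>{0..R}. ennreal (max 0 (ln (R / s)) * (s * L s)) \<partial>lborel)"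
  proof (intro nn_integral_cong)
    fix s show "ennreal (ln (R / s) * s * L s) * indicator {0..R} s
        = ennreal (max 0 (ln (R / s)) * (s * L s)) * indicator {0..R} s"
      by (cases "s = 0"; cases "s \<in> {0..R}") (auto simp: max_def mult.assoc)
  qed
  also have "\<dots> = (\<integral>\<^sup>+z\<in>?A. ennreal (max 0 (ln (R / norm (z - a))) * \<bar>laplacian u z\<bar>) \<partial>lborel)"
    unfolding L_def
    by (rule nn_integral_polar_annulus[symmetric])
      (use continuous_on_rabs[OF continuous_on_laplacian[OF u']] in simp_all)
  also have "\<dots> = (\<integral>\<^sup>+z\<in>cball a R. ennreal (ln (R / norm (z - a)) * \<bar>laplacian u z\<bar>) \<partial>lborel)"
    unfolding A
  proof (intro nn_integral_cong)
    fix z show "ennreal (max 0 (ln (R / norm (z - a))) * \<bar>laplacian u z\<bar>) * indicator (cball a R) z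
        = ennreal (ln (R / norm (z - a)) * \<bar>laplacian u z\<bar>) * indicator (cball a R) z"
      by (cases "z = a"; cases "z \<in> cball a R") (auto simp: max_def dist_norm norm_minus_commute)
  qed
  finally show ?thesis unfolding G_def M_def using R by (simp add: mult.commute)
qed

text \<open>The radial and tangential derivatives are the real and imaginary part of the gradient
  rotated by -t.\<close>

lemma grad_dominates_directional:
  "\<bar>dx u z * cos t + dy u z * sin t\<bar> \<le> norm (grad u z)"
  "\<bar>dy u z * cos t - dx u z * sin t\<bar> \<le> norm (grad u z)"
proof -
  have "Re (grad u z * cis (- t)) = dx u z * cos t + dy u z * sin t"
    "Im (grad u z * cis (- t)) = dy u z * cos t - dx u z * sin t"
    by (simp_all add: grad_def)
  then show "\<bar>dx u z * cos t + dy u z * sin t\<bar> \<le> norm (grad u z)"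
    "\<bar>dy u z * cos t - dx u z * sin t\<bar> \<le> norm (grad u z)"
    using abs_Re_le_cmod[of "grad u z * cis (- t)"] abs_Im_le_cmod[of "grad u z * cis (- t)"]
    by (simp_all add: norm_mult)
qed

text \<open>Only one-dimensional calculus is used: the oscillation on a circle is at most the
  integral of the gradient along it, and circle means at two radii differ by at most a radial
  integral of the gradient. The two summands of the constant belong to these two effects.\<close>

lemma poincare_annulus:
  assumes u: "smooth_on {z. r0 \<le> norm z \<and> norm z \<le> r1} u" and r: "0 < r0" "r0 \<le> \<rho>" "\<rho> \<le> r1"
  shows "(\<integral>\<^sup>+z\<in>{z. r0 \<le> norm z \<and> norm z \<le> r1}. ennreal \<bar>u z - circle_mean u \<rho>\<bar> \<partial>lborel)
    \<le> ennreal (2 * pi * r1 + r1 * (r1 - r0) / r0)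
       * (\<integral>\<^sup>+z\<in>{z. r0 \<le> norm z \<and> norm z \<le> r1}. ennreal (norm (grad u z)) \<partial>lborel)"
proof -
  let ?A = "{z. r0 \<le> norm (z - 0) \<and> norm (z - 0) \<le> r1}"
  have A: "?A = {z. r0 \<le> norm z \<and> norm z \<le> r1}" by simp
  note u' = u[folded A]
  have r0: "0 \<le> r0" using r by simp
  let ?c = "circle_mean u \<rho>"
  define M where "M r = integral {0..2*pi} (\<lambda>t. u (0 + of_real r * cis t))" for r
  define g where "g r = integral {0..2*pi} (\<lambda>t. norm (grad u (0 + of_real r * cis t)))" for r
  define X where "X = integral {r0..r1} (\<lambda>r. r * g r)"
  define G where "G = integral {r0..r1} g"
  note cu = smooth_on_imp_continuous_on[OF u']
  note cgrad = continuous_on_norm[OF continuous_on_grad[OF u']]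
  have cg: "continuous_on {r0..r1} g"
    unfolding g_def by (rule continuous_on_circle_integral[OF cgrad r0])
  note ccirc = continuous_on_circle[OF _ r0]
  have g0: "0 \<le> g r" if "r \<in> {r0..r1}" for r
    unfolding g_def using that by (intro integral_nonneg integrable_continuous_interval ccirc[OF cgrad]) auto
  \<comment> \<open>\<open>s * g s\<close> is the integral of |grad u| over the whole circle with
    respect to arc length, which dominates the integral over any arc.\<close>
  have osc: "\<bar>u (0 + of_real s * cis t) - u (0 + of_real s * cis t')\<bar> \<le> s * g s"
    if s: "s \<in> {r0..r1}" and tt: "0 \<le> t'" "t' \<le> t" "t \<le> 2*pi" for s t t'
  proof -
    let ?d = "\<lambda>t. s * (dy u (0 + of_real s * cis t) * cos t - dx u (0 + of_real s * cis t) * sin t)"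
    have "(?d has_integral (u (0 + of_real s * cis t) - u (0 + of_real s * cis t'))) {t'..t}"
    proof (rule fundamental_theorem_of_calculus[OF tt(2)])
      fix x
      have "0 + of_real s * cis x \<in> ?A" using s r by (simp add: norm_mult)
      from smooth_on_angular_derivative[OF u' this, of "{t'..t}"]
      show "((\<lambda>t. u (0 + of_real s * cis t)) has_vector_derivative ?d x) (at x within {t'..t})"
        by (simp add: has_real_derivative_iff_has_vector_derivative)
    qed
    note d = this
    note i = has_integral_integrable[OF d]
    have "\<bar>u (0 + of_real s * cis t) - u (0 + of_real s * cis t')\<bar> = \<bar>integral {t'..t} ?d\<bar>"
      using integral_unique[OF d] by (simp only:)
    also have "\<bar>integral {t'..t} ?d\<bar> \<le> integral {t'..t} (\<lambda>t. s * norm (grad u (0 + of_real s * cis t)))"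
    proof (rule abs_integral_le_integral[OF i])
      show "(\<lambda>t. s * norm (grad u (0 + of_real s * cis t))) integrable_on {t'..t}"
        using s by (intro integrable_continuous_interval continuous_on_mult_left ccirc[OF cgrad]) auto
      fix x show "\<bar>?d x\<bar> \<le> s * norm (grad u (0 + of_real s * cis x))"
        using s r grad_dominates_directional(2)[where u=u] by (simp add: abs_mult mult_left_mono)
    qed
    also have "\<dots> \<le> integral {0..2*pi} (\<lambda>t. s * norm (grad u (0 + of_real s * cis t)))"
      using s r tt by (intro integral_subset_le integrable_continuous_interval continuous_on_mult_left ccirc[OF cgrad]) auto
    also have "\<dots> = s * g s" unfolding g_def by simp
    finally show ?thesis .
  qed
  have dev: "\<bar>2 * pi * u (0 + of_real s * cis t) - M s\<bar> \<le> 2 * pi * (s * g s)"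
    if s: "s \<in> {r0..r1}" and t: "t \<in> {0..2*pi}" for s t
  proof -
    have i: "(\<lambda>t. u (0 + of_real s * cis t)) integrable_on {0..2*pi}"
      using s by (intro integrable_continuous_interval ccirc[OF cu])
    have "2 * pi * u (0 + of_real s * cis t) - M s
       = integral {0..2*pi} (\<lambda>t'. u (0 + of_real s * cis t) - u (0 + of_real s * cis t'))"
      unfolding M_def by (subst integral_diff) (use i in auto)
    also have "\<bar>\<dots>\<bar> \<le> integral {0..2*pi} (\<lambda>_. s * g s)"
    proof (rule abs_integral_le_integral)
      fix t' assume "t' \<in> {0..2*pi}"
      then show "\<bar>u (0 + of_real s * cis t) - u (0 + of_real s * cis t')\<bar> \<le> s * g s"
        using osc[OF s, of t t'] osc[OF s, of t' t] t by (cases "t' \<le> t") (auto simp: abs_minus_commute)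
    qed (use i in \<open>auto intro!: integrable_diff\<close>)
    also have "\<dots> = 2 * pi * (s * g s)" by simp
    finally show ?thesis .
  qed
  have MM: "\<bar>M y - M x\<bar> \<le> G" if xy: "x \<in> {r0..r1}" "y \<in> {r0..r1}" "x \<le> y" for x y
  proof -
    let ?d = "\<lambda>r. integral {0..2*pi} (\<lambda>t. dx u (0 + of_real r * cis t) * cos t + dy u (0 + of_real r * cis t) * sin t)"
    have "(?d has_integral (M y - M x)) {x..y}"
    proof (rule fundamental_theorem_of_calculus[OF xy(3)])
      fix s assume "s \<in> {x..y}"
      then have "(M has_real_derivative ?d s) (at s within {r0..r1})"
        unfolding M_def using xy by (intro circle_integral_derivative[OF u' r0]) auto
      then show "(M has_vector_derivative ?d s) (at s within {x..y})"
        using xy has_vector_derivative_within_subset[of M "?d s" s "{r0..r1}" "{x..y}"]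
        by (auto simp: has_real_derivative_iff_has_vector_derivative)
    qed
    note d = this
    note i = has_integral_integrable[OF d]
    have "\<bar>M y - M x\<bar> = \<bar>integral {x..y} ?d\<bar>"
      using integral_unique[OF d] by (simp only:)
    also have "\<bar>integral {x..y} ?d\<bar> \<le> integral {x..y} g"
    proof (rule abs_integral_le_integral[OF i])
      show "g integrable_on {x..y}"
        using xy by (intro integrable_continuous_interval continuous_on_subset[OF cg]) auto
      fix s assume "s \<in> {x..y}"
      then have s: "s \<in> {r0..r1}" using xy by auto
      show "\<bar>?d s\<bar> \<le> g s"
        unfolding g_def
        using s by (intro abs_integral_le_integral integrable_continuous_interval continuous_intros
            ccirc[OF smooth_on_imp_continuous_on[OF smooth_on_dx[OF u']]]
            ccirc[OF smooth_on_imp_continuous_on[OF smooth_on_dy[OF u']]]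
            ccirc[OF continuous_on_grad[OF u']] grad_dominates_directional)
    qed
    also have "\<dots> \<le> G"
      unfolding G_def using xy g0
      by (intro integral_subset_le integrable_continuous_interval continuous_on_subset[OF cg]) auto
    finally show ?thesis .
  qed
  have c: "2 * pi * ?c = M \<rho>" by (simp add: circle_mean_def M_def)
  have pw: "\<bar>u (0 + of_real s * cis t) - ?c\<bar> \<le> s * g s + G / (2 * pi)"
    if s: "s \<in> {r0..r1}" and t: "t \<in> {0..2*pi}" for s t
  proof -
    have "\<bar>M s - M \<rho>\<bar> \<le> G"
      using MM[of s \<rho>] MM[of \<rho> s] s r by (cases "s \<le> \<rho>") (auto simp: abs_minus_commute)
    with dev[OF s t] c have "\<bar>2 * pi * u (0 + of_real s * cis t) - 2 * pi * ?c\<bar> \<le> 2 * pi * (s * g s) + G"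
      by linarith
    moreover have "2 * pi * u (0 + of_real s * cis t) - 2 * pi * ?c = 2 * pi * (u (0 + of_real s * cis t) - ?c)"
      by (simp only: right_diff_distrib)
    moreover have "2 * pi * (s * g s) + G = 2 * pi * (s * g s + G / (2 * pi))"
      by (simp add: distrib_left)
    ultimately have "\<bar>2 * pi * (u (0 + of_real s * cis t) - ?c)\<bar> \<le> 2 * pi * (s * g s + G / (2 * pi))"
      by (simp only:)
    then have "2 * pi * \<bar>u (0 + of_real s * cis t) - ?c\<bar> \<le> 2 * pi * (s * g s + G / (2 * pi))"
      by (simp only: abs_mult) simp
    then show ?thesis by (rule mult_left_le_imp_le) simp
  qed
  have crg: "continuous_on {r0..r1} (\<lambda>r. r * g r)" by (intro continuous_intros cg)
  have X0: "0 \<le> X"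
    unfolding X_def using g0 r by (intro integral_nonneg integrable_continuous_interval crg) auto
  \<comment> \<open>\<open>G\<close> integrates against dr and \<open>X\<close> against the area
    element r dr; comparing them costs the factor 1 / \<open>r0\<close>.\<close>
  have GX: "G \<le> X / r0"
  proof -
    have "G \<le> integral {r0..r1} (\<lambda>r. (r * g r) / r0)"
      unfolding G_def
    proof (rule integral_le)
      fix s assume s: "s \<in> {r0..r1}"
      then have "r0 * g s \<le> s * g s" using g0[OF s] by (intro mult_right_mono) auto
      then show "g s \<le> (s * g s) / r0" using r by (simp add: field_simps)
    qed (use r in \<open>auto intro!: integrable_continuous_interval continuous_intros cg\<close>)
    then show ?thesis by (simp add: X_def)
  qed
  have grad_X: "(\<integral>\<^sup>+z\<in>?A. ennreal (norm (grad u z)) \<partial>lborel) = ennreal X"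
  proof -
    have "(\<integral>\<^sup>+z\<in>?A. ennreal (norm (grad u z)) \<partial>lborel) = (\<integral>\<^sup>+r\<in>{r0..r1}. ennreal (r * g r) \<partial>lborel)"
      using nn_integral_polar_annulus[OF cgrad norm_ge_zero, of "\<lambda>_. 1"] r0 by (simp add: g_def)
    also have "\<dots> = ennreal X"
      unfolding X_def using g0 r by (intro ennreal_integral_Icc crg) auto
    finally show ?thesis .
  qed
  define W where "W r = integral {0..2*pi} (\<lambda>t. \<bar>u (0 + of_real r * cis t) - ?c\<bar>)" for r
  have cabs: "continuous_on ?A (\<lambda>z. \<bar>u z - ?c\<bar>)" by (intro continuous_intros cu)
  have cW: "continuous_on {r0..r1} (\<lambda>r. r * W r)"
    unfolding W_def by (intro continuous_intros continuous_on_circle_integral cabs r0)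
  have W: "W s \<le> 2 * pi * (s * g s) + G" if s: "s \<in> {r0..r1}" for s
  proof -
    have "W s \<le> integral {0..2*pi} (\<lambda>_. s * g s + G / (2 * pi))"
      unfolding W_def using s
      by (intro integral_le pw integrable_continuous_interval ccirc[OF cabs] continuous_intros)
    then show ?thesis by (simp add: distrib_left mult.assoc)
  qed
  have W0: "0 \<le> W s" if s: "s \<in> {r0..r1}" for s
    unfolding W_def using s by (intro integral_nonneg integrable_continuous_interval ccirc[OF cabs]) auto
  have "(\<integral>\<^sup>+z\<in>?A. ennreal \<bar>u z - ?c\<bar> \<partial>lborel) = (\<integral>\<^sup>+r\<in>{r0..r1}. ennreal (r * W r) \<partial>lborel)"
    using nn_integral_polar_annulus[OF cabs abs_ge_zero, of "\<lambda>_. 1"] r0 by (simp add: W_def)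
  also have "\<dots> = ennreal (integral {r0..r1} (\<lambda>r. r * W r))"
    using W0 r by (intro ennreal_integral_Icc cW) auto
  also have "\<dots> \<le> ennreal ((2 * pi * r1 + r1 * (r1 - r0) / r0) * X)"
  proof (rule ennreal_leI)
    have "integral {r0..r1} (\<lambda>r. r * W r) \<le> integral {r0..r1} (\<lambda>r. 2 * pi * r1 * (r * g r) + r1 * G)"
    proof (rule integral_le)
      fix s assume s: "s \<in> {r0..r1}"
      have "s * W s \<le> r1 * W s" using s W0[OF s] by (intro mult_right_mono) auto
      also have "\<dots> \<le> r1 * (2 * pi * (s * g s) + G)" using s r W[OF s] by (intro mult_left_mono) auto
      finally show "s * W s \<le> 2 * pi * r1 * (s * g s) + r1 * G" by (simp add: algebra_simps)
    qed (auto intro!: integrable_continuous_interval cW continuous_intros cg)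
    also have "\<dots> = 2 * pi * r1 * X + (r1 - r0) * (r1 * G)"
      unfolding X_def using r
      by (subst integral_add) (auto intro!: integrable_continuous_interval continuous_intros cg)
    also have "(r1 - r0) * (r1 * G) \<le> (r1 - r0) * (r1 * (X / r0))"
      using GX r by (intro mult_left_mono) auto
    finally show "integral {r0..r1} (\<lambda>r. r * W r) \<le> (2 * pi * r1 + r1 * (r1 - r0) / r0) * X"
      by (simp add: algebra_simps)
  qed
  also have "\<dots> = ennreal (2 * pi * r1 + r1 * (r1 - r0) / r0) * ennreal X"
    using X0 r by (intro ennreal_mult) auto
  finally show ?thesis unfolding grad_X[symmetric] A .
qed

subsection \<open>Weak-L2 functions and one-dimensional logarithmic potentials\<close>

lemma weak_L2_norm_less_D:
  assumes "weak_L2_norm A f < ennreal \<Lambda>" "0 < \<Lambda>" "0 < t"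
  shows "emeasure lborel {z \<in> A. norm (f z) > t} \<le> ennreal (\<Lambda>\<^sup>2 / t\<^sup>2)"
proof -
  obtain C where C: "C < ennreal \<Lambda>" "\<And>t. t > 0 \<Longrightarrow> emeasure lborel {z \<in> A. norm (f z) > t} \<le> C\<^sup>2 / ennreal (t\<^sup>2)"
    using assms(1) unfolding weak_L2_norm_def Inf_less_iff by auto
  have "emeasure lborel {z \<in> A. norm (f z) > t} \<le> C\<^sup>2 / ennreal (t\<^sup>2)" using C(2) assms(3) by simp
  also have "\<dots> \<le> (ennreal \<Lambda>)\<^sup>2 / ennreal (t\<^sup>2)"
    using C(1) by (intro divide_right_mono_ennreal power_mono) auto
  also have "\<dots> = ennreal (\<Lambda>\<^sup>2 / t\<^sup>2)"
    using assms by (simp add: ennreal_power divide_ennreal)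
  finally show ?thesis .
qed

text \<open>A discrete layer-cake formula. For x > 1 take the least n with x \<le> 2^n; then x \<le>
  2^n = 1 + (sum of 2^k for k < n), and every such k satisfies 2^k < x.\<close>

lemma le_one_plus_dyadic_sum:
  fixes x :: real
  shows "ennreal x \<le> 1 + (\<Sum>k. ennreal (2 ^ k) * of_bool (2 ^ k < x))"
proof (cases "x \<le> 1")
  case True
  then have "ennreal x \<le> ennreal 1" by (rule ennreal_leI)
  then show ?thesis by (metis add_increasing2 ennreal_1 zero_le)
next
  case False
  obtain n where "x \<le> 2 ^ n" using real_arch_pow[of 2 x] by (auto intro: less_imp_le)
  define n where "n = (LEAST n. x \<le> 2 ^ n)"
  have n: "x \<le> 2 ^ n" unfolding n_def by (rule LeastI) fact
  have lt: "2 ^ k < x" if "k < n" for k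
    using not_less_Least[of k "\<lambda>n. x \<le> 2 ^ n"] that unfolding n_def by auto
  have "(2::real) ^ n = 1 + (\<Sum>k<n. 2 ^ k)" by (simp add: sum_gp_strict)
  then have "ennreal x \<le> ennreal (1 + (\<Sum>k<n. 2 ^ k))" using n by (intro ennreal_leI) simp
  also have "\<dots> = 1 + (\<Sum>k<n. ennreal (2 ^ k))" by (simp add: ennreal_plus sum_nonneg del: sum_ennreal flip: sum_ennreal ennreal_1)
  also have "(\<Sum>k<n. ennreal (2 ^ k)) = (\<Sum>k<n. ennreal (2 ^ k) * of_bool (2 ^ k < x))"
    using lt by (intro sum.cong) auto
  also have "1 + \<dots> \<le> 1 + (\<Sum>k. ennreal (2 ^ k) * of_bool (2 ^ k < x))"
    by (intro add_left_mono sum_le_suminf) auto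
  finally show ?thesis .
qed

text \<open>The level set at height 2^k has measure at most \<Lambda>^2 / 4^k, so the dyadic layers
  form a geometric series with sum 2 \<Lambda>^2. The layer below height 1 costs the measure of
  \<open>K\<close>.\<close>

lemma nn_integral_norm_le_weak_L2:
  fixes f :: "complex \<Rightarrow> complex"
  assumes w: "weak_L2_norm A f < ennreal \<Lambda>" "0 < \<Lambda>"
    and f: "continuous_on A f" and A: "A \<in> sets borel" and K: "K \<in> sets borel" "K \<subseteq> A"
  shows "(\<integral>\<^sup>+z\<in>K. ennreal (norm (f z)) \<partial>lborel) \<le> emeasure lborel K + ennreal (2 * \<Lambda>\<^sup>2)"
proof -
  have m: "{z \<in> A. t < norm (f z)} \<in> sets borel" for t :: real
  proof -
    have [measurable]: "(\<lambda>z. indicator A z *\<^sub>R f z) \<in> borel_measurable borel"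
      by (rule borel_measurable_continuous_on_indicator[OF A f])
    have "{z \<in> space borel. t < norm (indicator A z *\<^sub>R f z)} \<inter> A \<in> sets borel"
      using A by measurable
    also have "{z \<in> space borel. t < norm (indicator A z *\<^sub>R f z)} \<inter> A = {z \<in> A. t < norm (f z)}"
      by auto
    finally show ?thesis .
  qed
  note [measurable] = m A K(1)
  have "(\<integral>\<^sup>+z\<in>K. ennreal (norm (f z)) \<partial>lborel)
     \<le> (\<integral>\<^sup>+z. indicator K z + (\<Sum>k. ennreal (2 ^ k) * indicator {z \<in> A. 2 ^ k < norm (f z)} z) \<partial>lborel)"
  proof (rule nn_integral_mono)
    fix z
    show "ennreal (norm (f z)) * indicator K z
      \<le> indicator K z + (\<Sum>k. ennreal (2 ^ k) * indicator {z \<in> A. 2 ^ k < norm (f z)} z)"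
      using le_one_plus_dyadic_sum[of "norm (f z)"] K(2) by (cases "z \<in> K") (auto simp: indicator_def)
  qed
  also have "\<dots> = emeasure lborel K + (\<Sum>k. ennreal (2 ^ k) * emeasure lborel {z \<in> A. 2 ^ k < norm (f z)})"
    by (simp add: nn_integral_add nn_integral_suminf nn_integral_cmult_indicator)
  also have "\<dots> \<le> emeasure lborel K + (\<Sum>k. ennreal (\<Lambda>\<^sup>2 * (1/2) ^ k))"
  proof (intro add_left_mono suminf_le summableI)
    fix k
    have "ennreal (2 ^ k) * emeasure lborel {z \<in> A. 2 ^ k < norm (f z)} \<le> ennreal (2 ^ k) * ennreal (\<Lambda>\<^sup>2 / (2 ^ k)\<^sup>2)"
      by (intro mult_left_mono weak_L2_norm_less_D[OF w]) auto
    also have "\<dots> = ennreal (\<Lambda>\<^sup>2 * (1/2) ^ k)"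
      by (simp add: ennreal_mult[symmetric] power_divide power2_eq_square)
    finally show "ennreal (2 ^ k) * emeasure lborel {z \<in> A. 2 ^ k < norm (f z)} \<le> ennreal (\<Lambda>\<^sup>2 * (1/2) ^ k)" .
  qed
  also have "(\<Sum>k. ennreal (\<Lambda>\<^sup>2 * (1/2) ^ k)) = ennreal (2 * \<Lambda>\<^sup>2)"
  proof (rule suminf_ennreal_eq)
    show "(\<lambda>k. \<Lambda>\<^sup>2 * (1/2) ^ k) sums (2 * \<Lambda>\<^sup>2)"
      using sums_mult[OF geometric_sums[of "1/2::real"], of "\<Lambda>\<^sup>2"] by (simp add: mult.commute)
  qed simp
  finally show ?thesis .
qed

text \<open>\<open>ln 0 = 0\<close> makes \<open>log_kernel 0 = 0\<close> instead of infinity, so bounds by this kernel hold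
  almost everywhere only.\<close>
definition log_kernel :: "real \<Rightarrow> real" where
  "log_kernel x = max 0 (- ln (2 * \<bar>x\<bar>))"

lemma log_kernel_nonneg: "0 \<le> log_kernel x"
  by (simp add: log_kernel_def)

lemma borel_measurable_log_kernel [measurable]: "log_kernel \<in> borel_measurable borel"
  unfolding log_kernel_def[abs_def] by measurable

lemma exp_half_log_kernel:
  assumes "x \<in> {-1/2..1/2}" "x \<noteq> 0"
  shows "exp (log_kernel x / 2) = 1 / sqrt (2 * \<bar>x\<bar>)"
proof -
  have "2 * \<bar>x\<bar> \<le> 1" "0 < 2 * \<bar>x\<bar>" using assms by auto
  then have "log_kernel x / 2 = - ln (sqrt (2 * \<bar>x\<bar>))"
    unfolding log_kernel_def by (simp add: ln_sqrt max_def)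
  then show ?thesis using assms by (simp add: exp_minus inverse_eq_divide)
qed

text \<open>Away from 0 the integrand is |2x| to the power -1/2. Its antiderivatives sqrt (2x) and -
  sqrt (-2x) on the two halves are continuous up to 0, so the fundamental theorem on open intervals
  applies despite the singularity.\<close>

lemma has_integral_exp_half_log_kernel:
  "((\<lambda>x. exp (log_kernel x / 2)) has_integral 2) {-1/2..1/2}"
proof -
  have pos: "((\<lambda>x. exp (log_kernel x / 2)) has_integral (sqrt (2 * (1/2)) - sqrt (2 * 0))) {0..1/2}"
  proof (rule fundamental_theorem_of_calculus_interior)
    fix x :: real assume x: "x \<in> {0<..<1/2}"
    then have "((\<lambda>x. sqrt (2 * x)) has_real_derivative exp (log_kernel x / 2)) (at x)"
      by (subst exp_half_log_kernel) (auto intro!: derivative_eq_intros simp: field_simps)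
    then show "((\<lambda>x. sqrt (2 * x)) has_vector_derivative exp (log_kernel x / 2)) (at x)"
      by (simp add: has_real_derivative_iff_has_vector_derivative)
  qed (auto intro!: continuous_intros)
  have neg: "((\<lambda>x. exp (log_kernel x / 2)) has_integral (- sqrt (- 2 * 0) - - sqrt (- 2 * (-1/2)))) {-1/2..0}"
  proof (rule fundamental_theorem_of_calculus_interior)
    fix x :: real assume x: "x \<in> {-1/2<..<0}"
    then have "((\<lambda>x. - sqrt (- 2 * x)) has_real_derivative exp (log_kernel x / 2)) (at x)"
      by (subst exp_half_log_kernel) (auto intro!: derivative_eq_intros simp: field_simps)
    then show "((\<lambda>x. - sqrt (- 2 * x)) has_vector_derivative exp (log_kernel x / 2)) (at x)"
      by (simp add: has_real_derivative_iff_has_vector_derivative)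
  qed (auto intro!: continuous_intros)
  show ?thesis using has_integral_combine[OF _ _ neg pos] by simp
qed

text \<open>The convolution of \<open>h\<close> with the kernel. Shifting \<open>h\<close> instead
  of the kernel keeps the singularity at x = 0 for every r, so continuity in r is dominated
  convergence with one fixed majorant.\<close>

definition log_potential :: "(real \<Rightarrow> real) \<Rightarrow> real \<Rightarrow> real" where
  "log_potential h r = integral {-1/2..1/2} (\<lambda>x. log_kernel x * h (r + x))"

text \<open>One majorant covers both kernels in use: \<open>exp (log_kernel x / 2)\<close> itself,
  and \<open>log_kernel x\<close> by 1 + y \<le> exp y.\<close>

lemma kernel_mult_bounded_integrable:
  fixes k h :: "real \<Rightarrow> real"
  assumes [measurable]: "k \<in> borel_measurable borel" "h \<in> borel_measurable borel"
    and k: "\<And>x. 0 \<le> k x" "\<And>x. k x \<le> 2 * exp (log_kernel x / 2)" and h: "\<And>x. \<bar>h x\<bar> \<le> H"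
  shows "(\<lambda>x. k x * h x) integrable_on {-1/2..1/2}"
proof -
  have H: "0 \<le> H" using h[of 0] by linarith
  have m: "(\<lambda>x. k x * h x) \<in> borel_measurable (lebesgue_on {-1/2..1/2})"
    by (intro measurable_restrict_space1 measurable_completion) measurable
  have g: "(\<lambda>x. 2 * H * exp (log_kernel x / 2)) integrable_on {-1/2..1/2}"
    using has_integral_exp_half_log_kernel by (intro integrable_on_mult_right) blast
  have "norm (k x * h x) \<le> 2 * H * exp (log_kernel x / 2)" for x
    using mult_mono[OF k(2)[of x] h[of x]] k(1)[of x] H by (simp add: abs_mult mult_ac)
  then show ?thesis
    by (intro measurable_bounded_by_integrable_imp_integrable[OF m g]) simp_all
qed

lemma log_kernel_le_exp: "log_kernel x \<le> 2 * exp (log_kernel x / 2)"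
  using exp_ge_add_one_self[of "log_kernel x / 2"] by linarith

text \<open>In the application \<open>h\<close> is s times the circle integral of |\<Delta>u| at
  radius s, divided by 2 pi and raised by 1/16. The interval \<open>{1/2..5/2}\<close> is what a
  window of half-width 1/2 about a radius in \<open>{1..2}\<close> can reach. \<open>H\<close>
  serves integrability and dominated convergence; the bound 8 below is independent of it.\<close>

context
  fixes h :: "real \<Rightarrow> real" and H :: real
  assumes cont: "continuous_on UNIV h" and lower: "\<And>x. 1/16 \<le> h x" and upper: "\<And>x. h x \<le> H"
    and mass: "(\<integral>\<^sup>+s\<in>{1/2..5/2}. ennreal (h s) \<partial>lborel) \<le> ennreal (1/4)"
begin

lemma borel_measurable_density: "h \<in> borel_measurable borel"
  using cont by (rule borel_measurable_continuous_onI)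

lemma abs_density_le: "\<bar>h x\<bar> \<le> H" using lower[of x] upper[of x] by linarith

lemma log_potential_integrable: "(\<lambda>x. log_kernel x * h (r + x)) integrable_on {-1/2..1/2}"
  by (rule kernel_mult_bounded_integrable[where H=H])
    (use borel_measurable_density in \<open>simp_all add: log_kernel_nonneg log_kernel_le_exp abs_density_le\<close>)

lemma log_potential_nonneg: "0 \<le> log_potential h r"
  unfolding log_potential_def using lower
  by (intro integral_nonneg log_potential_integrable mult_nonneg_nonneg log_kernel_nonneg)
    (meson order.trans zero_le_divide_1_iff zero_le_numeral)

lemma ennreal_log_potential:
  "(\<integral>\<^sup>+x\<in>{-1/2..1/2}. ennreal (log_kernel x * h (r + x)) \<partial>lborel) = ennreal (log_potential h r)"
  unfolding log_potential_def
  by (rule nn_integral_has_integral_lebesgue'[OF _ integrable_integral[OF log_potential_integrable]])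
    (meson mult_nonneg_nonneg log_kernel_nonneg lower order.trans zero_le_divide_1_iff zero_le_numeral)

lemma continuous_on_log_potential: "continuous_on S (log_potential h)"
proof (unfold continuous_on_sequentially comp_def, intro allI ballI impI)
  fix X a assume a: "a \<in> S" "(\<forall>n. X n \<in> S) \<and> X \<longlonglongrightarrow> a"
  show "(\<lambda>n. log_potential h (X n)) \<longlonglongrightarrow> log_potential h a"
    unfolding log_potential_def
  proof (rule dominated_convergence)
    show "(\<lambda>x. log_kernel x * h (X n + x)) integrable_on {-1/2..1/2}" for n
      by (rule log_potential_integrable)
    show "(\<lambda>x. log_kernel x * H) integrable_on {-1/2..1/2}"
      by (rule kernel_mult_bounded_integrable[where H="\<bar>H\<bar>"])
        (simp_all add: log_kernel_nonneg log_kernel_le_exp)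
    show "norm (log_kernel x * h (X n + x)) \<le> log_kernel x * H" for n x
      using mult_left_mono[OF abs_density_le log_kernel_nonneg] by (simp add: abs_mult log_kernel_nonneg)
    fix x
    have "isCont h (a + x)" using cont by (simp add: continuous_on_eq_continuous_at)
    then have "(\<lambda>n. h (X n + x)) \<longlonglongrightarrow> h (a + x)"
      by (rule isCont_tendsto_compose) (use a in \<open>auto intro!: tendsto_intros\<close>)
    then show "(\<lambda>n. log_kernel x * h (X n + x)) \<longlonglongrightarrow> log_kernel x * h (a + x)"
      by (rule tendsto_mult_left)
  qed
qed

text \<open>Jensen's inequality: the tangent to \<open>exp\<close> at \<open>2 * log_potential h r\<close> is integrated
  against the measure with density \<open>h\<close>, whose mass lies between 1/16 and 1/4.\<close>
lemma exp_log_potential_le: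
  assumes r: "r \<in> {1..2}"
  shows "exp (2 * log_potential h r)
    \<le> integral {-1/2..1/2} (\<lambda>x. 16 * (exp (log_kernel x / 2) * h (r + x)))"
proof -
  note [measurable] = borel_measurable_density
  define p where "p = log_potential h r"
  define m where "m = integral {-1/2..1/2} (\<lambda>x. h (r + x))"
  have hr: "continuous_on S (\<lambda>x. h (r + x))" for S
    by (rule continuous_on_compose2[OF cont]) (auto intro!: continuous_intros)
  have hi: "(\<lambda>x. h (r + x)) integrable_on {-1/2..1/2}"
    by (intro integrable_continuous_interval hr)
  have "integral {-1/2..1/2 :: real} (\<lambda>x. 1/16 :: real) \<le> m"
    unfolding m_def by (rule integral_le) (use hi lower in auto)
  then have m16: "1/16 \<le> m" by simp
  have "ennreal m = (\<integral>\<^sup>+x\<in>{-1/2..1/2}. ennreal (h (r + x)) \<partial>lborel)"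
    unfolding m_def using lower by (intro ennreal_integral_Icc[symmetric] hr) (meson order.trans zero_le_divide_1_iff zero_le_numeral)
  also have "\<dots> \<le> (\<integral>\<^sup>+x. ennreal (h (r + 1 * x)) * indicator {1/2..5/2} (r + 1 * x) \<partial>lborel)"
    using r by (intro nn_integral_mono) (auto simp: indicator_def)
  also have "\<dots> = (\<integral>\<^sup>+s\<in>{1/2..5/2}. ennreal (h s) \<partial>lborel)"
    by (subst (2) nn_integral_real_affine[where c=1 and t=r]) auto
  also note mass
  finally have m4: "m \<le> 1/4" using m16 by (subst (asm) ennreal_le_iff) auto
  have Ji: "(\<lambda>x. exp (log_kernel x / 2) * h (r + x)) integrable_on {-1/2..1/2}"
    by (rule kernel_mult_bounded_integrable[where H=H]) (simp_all add: abs_density_le)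
  \<comment> \<open>With respect to \<open>h\<close> divided by its window mass \<open>m\<close>,
    the function \<open>2 * m * log_kernel x\<close> has mean \<open>2 * p\<close>, so the linear
    term of the tangent integrates to zero and exp (2p) m remains. The bound m \<le> 1/4 replaces
    exp (2 m \<open>log_kernel\<close>) by the integrable exp (\<open>log_kernel\<close> / 2); at
    the end m \<ge> 1/16 yields the factor 16.\<close>
  have "integral {-1/2..1/2} (\<lambda>x. exp (2 * p) * ((1 - 2 * p) * h (r + x) + 2 * m * (log_kernel x * h (r + x))))
      \<le> integral {-1/2..1/2} (\<lambda>x. exp (log_kernel x / 2) * h (r + x))"
  proof (rule integral_le)
    show "(\<lambda>x. exp (2 * p) * ((1 - 2 * p) * h (r + x) + 2 * m * (log_kernel x * h (r + x)))) integrable_on {-1/2..1/2}"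
      by (intro integrable_on_mult_right integrable_add hi log_potential_integrable)
    fix x
    have "exp (2 * p) * (1 + (2 * m * log_kernel x - 2 * p)) \<le> exp (2 * p) * exp (2 * m * log_kernel x - 2 * p)"
      by (intro mult_left_mono exp_ge_add_one_self) auto
    also have "\<dots> = exp (2 * m * log_kernel x)" by (simp add: exp_add[symmetric])
    also have "\<dots> \<le> exp (log_kernel x / 2)"
      using mult_right_mono[OF m4 log_kernel_nonneg[of x]] by simp
    finally have "exp (2 * p) * (1 + (2 * m * log_kernel x - 2 * p)) * h (r + x) \<le> exp (log_kernel x / 2) * h (r + x)"
      using lower[of "r + x"] by (intro mult_right_mono) auto
    then show "exp (2 * p) * ((1 - 2 * p) * h (r + x) + 2 * m * (log_kernel x * h (r + x)))
        \<le> exp (log_kernel x / 2) * h (r + x)"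
      by (simp add: algebra_simps)
  qed (rule Ji)
  also have "integral {-1/2..1/2} (\<lambda>x. exp (2 * p) * ((1 - 2 * p) * h (r + x) + 2 * m * (log_kernel x * h (r + x))))
     = exp (2 * p) * ((1 - 2 * p) * m + 2 * m * p)"
    unfolding m_def p_def log_potential_def
    by (intro integral_unique has_integral_mult_right has_integral_add integrable_integral
        hi log_potential_integrable)
  also have "\<dots> = exp (2 * p) * m" by (simp add: algebra_simps)
  finally have "exp (2 * p) * m \<le> integral {-1/2..1/2} (\<lambda>x. exp (log_kernel x / 2) * h (r + x))" .
  moreover have "exp (2 * p) * (1/16) \<le> exp (2 * p) * m" using m16 by (intro mult_left_mono) auto
  ultimately show ?thesis unfolding p_def integral_mult_right by linarith
qed

text \<open>After exchanging the integrals, \<open>h (r + x)\<close> integrated over r in [1, 2] is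
  at most the mass 1/4 for each x, and the kernel integrates to 2. Hence 16 * 1/4 * 2 = 8.\<close>

lemma integral_exp_log_potential_le: "integral {1..2} (\<lambda>r. exp (2 * log_potential h r)) \<le> 8"
proof -
  note [measurable] = borel_measurable_density
  let ?J = "\<lambda>x. exp (log_kernel x / 2)"
  have h0: "0 \<le> h x" for x using lower[of x] by linarith
  have Ji: "(\<lambda>x. 16 * (?J x * h (r + x))) integrable_on {-1/2..1/2}" for r
    by (intro integrable_on_mult_right kernel_mult_bounded_integrable[where H=H]) (simp_all add: abs_density_le)
  have c: "continuous_on {1..2} (\<lambda>r. exp (2 * log_potential h r))"
    by (intro continuous_intros continuous_on_log_potential)
  have "ennreal (integral {1..2} (\<lambda>r. exp (2 * log_potential h r)))
     = (\<integral>\<^sup>+r\<in>{1..2}. ennreal (exp (2 * log_potential h r)) \<partial>lborel)"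
    by (rule ennreal_integral_Icc[OF c, symmetric]) simp
  also have "\<dots> \<le> (\<integral>\<^sup>+r\<in>{1..2}. ennreal (integral {-1/2..1/2} (\<lambda>x. 16 * (?J x * h (r + x)))) \<partial>lborel)"
    using exp_log_potential_le by (intro nn_integral_mono) (auto simp: indicator_def intro!: ennreal_leI)
  also have "\<dots> = (\<integral>\<^sup>+r. \<integral>\<^sup>+x. ennreal (16 * (?J x * h (r + x))) * indicator {-1/2..1/2} x * indicator {1..2} r \<partial>lborel \<partial>lborel)"
  proof (intro nn_integral_cong)
    fix r
    have "(\<integral>\<^sup>+x\<in>{-1/2..1/2}. ennreal (16 * (?J x * h (r + x))) \<partial>lborel)
        = ennreal (integral {-1/2..1/2} (\<lambda>x. 16 * (?J x * h (r + x))))"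
      using h0 by (intro nn_integral_has_integral_lebesgue' integrable_integral Ji) auto
    then show "ennreal (integral {-1/2..1/2} (\<lambda>x. 16 * (?J x * h (r + x)))) * indicator {1..2} r
        = (\<integral>\<^sup>+x. ennreal (16 * (?J x * h (r + x))) * indicator {-1/2..1/2} x * indicator {1..2} r \<partial>lborel)"
      by (subst nn_integral_multc) auto
  qed
  also have "\<dots> = (\<integral>\<^sup>+x. \<integral>\<^sup>+r. ennreal (16 * (?J x * h (r + x))) * indicator {-1/2..1/2} x * indicator {1..2} r \<partial>lborel \<partial>lborel)"
    by (rule lborel_pair.Fubini') measurable
  also have "\<dots> \<le> (\<integral>\<^sup>+x\<in>{-1/2..1/2}. ennreal (4 * ?J x) \<partial>lborel)"
  proof (rule nn_integral_mono)
    fix x :: real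
    show "(\<integral>\<^sup>+r. ennreal (16 * (?J x * h (r + x))) * indicator {-1/2..1/2} x * indicator {1..2} r \<partial>lborel)
      \<le> ennreal (4 * ?J x) * indicator {-1/2..1/2} x"
    proof (cases "x \<in> {-1/2..1/2}")
      case True
      have "(\<integral>\<^sup>+r. ennreal (16 * (?J x * h (r + x))) * indicator {-1/2..1/2} x * indicator {1..2} r \<partial>lborel)
        = (\<integral>\<^sup>+r. ennreal (16 * ?J x) * (ennreal (h (r + x)) * indicator {1..2} r) \<partial>lborel)"
        using True h0 by (intro nn_integral_cong) (simp add: ennreal_mult'[symmetric] mult.assoc indicator_def)
      also have "\<dots> = ennreal (16 * ?J x) * (\<integral>\<^sup>+r. ennreal (h (r + x)) * indicator {1..2} r \<partial>lborel)"
        by (rule nn_integral_cmult) measurable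
      also have "(\<integral>\<^sup>+r. ennreal (h (r + x)) * indicator {1..2} r \<partial>lborel)
          \<le> (\<integral>\<^sup>+r. ennreal (h (x + 1 * r)) * indicator {1/2..5/2} (x + 1 * r) \<partial>lborel)"
        using True by (intro nn_integral_mono) (auto simp: indicator_def add.commute)
      also have "\<dots> = (\<integral>\<^sup>+s\<in>{1/2..5/2}. ennreal (h s) \<partial>lborel)"
        by (subst (2) nn_integral_real_affine[where c=1 and t=x]) auto
      also note mass
      also have "ennreal (16 * ?J x) * ennreal (1/4) = ennreal (4 * ?J x)"
        by (simp add: ennreal_mult'[symmetric])
      finally show ?thesis using True by (simp add: mult_left_mono)
    qed simp
  qed
  also have "\<dots> = ennreal (4 * 2)"
    by (intro nn_integral_has_integral_lebesgue' has_integral_mult_right has_integral_exp_half_log_kernel) auto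
  finally show ?thesis by (subst (asm) ennreal_le_iff) auto
qed

end

subsection \<open>Radial bound for the conformal factor\<close>

lemma AE_lborel_norm_neq: "AE z in lborel. norm (z::complex) \<noteq> r"
proof -
  have "sphere (0::complex) r \<in> null_sets lborel"
    using negligible_sphere[of "0::complex" r] by (simp add: negligible_iff_null_sets null_sets_completion_iff)
  from AE_not_in[OF this] show ?thesis by simp
qed

text \<open>The reverse triangle inequality, with R \<le> 1/2 matching the factor 2 in
  \<open>log_kernel\<close>. On the excluded circle the kernel has its default value 0 in place of
  infinity; that circle is null.\<close>

lemma ln_quotient_le_log_kernel:
  fixes z a :: complex
  assumes "norm z \<noteq> norm a" "0 < R" "R \<le> 1/2"
  shows "ln (R / norm (z - a)) \<le> log_kernel (norm z - norm a)"
proof -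
  have d: "0 < \<bar>norm z - norm a\<bar>" "\<bar>norm z - norm a\<bar> \<le> norm (z - a)"
    using assms(1) norm_triangle_ineq3[of z a] by auto
  then have "R / norm (z - a) \<le> (1/2) / \<bar>norm z - norm a\<bar>"
    using assms by (intro frac_le) auto
  then have "ln (R / norm (z - a)) \<le> ln (1 / (2 * \<bar>norm z - norm a\<bar>))"
    using d assms(2) order.strict_trans2[OF d] by (subst ln_le_cancel_iff) auto
  also have "\<dots> = - ln (2 * \<bar>norm z - norm a\<bar>)" using d by (simp add: ln_div)
  finally show ?thesis unfolding log_kernel_def by simp
qed

lemma log_kernel_eq_0: "x \<notin> {-1/2..1/2} \<Longrightarrow> log_kernel x = 0"
  unfolding log_kernel_def by (auto simp: max_def)

lemma cball_subset_annulus: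
  fixes a :: complex
  assumes "1 \<le> norm a" "norm a \<le> 2" "R \<le> 1/2"
  shows "cball a R \<subseteq> {z. 1/2 \<le> norm z \<and> norm z \<le> 5/2}"
proof
  fix z assume "z \<in> cball a R"
  then have "norm (z - a) \<le> 1/2" using assms by (simp add: dist_norm norm_minus_commute)
  moreover have "\<bar>norm z - norm a\<bar> \<le> norm (z - a)" by (rule norm_triangle_ineq3)
  ultimately show "z \<in> {z. 1/2 \<le> norm z \<and> norm z \<le> 5/2}" using assms by auto
qed

text \<open>The function \<phi> is the potential of the radial density of |\<Delta>u| on the whole
  annulus. It depends neither on the centre nor on the radius of the small circle, so it can be
  fixed before both.\<close>

lemma circle_mean_deviation_bound:
  assumes u: "smooth_on {z. 1/2 \<le> norm z \<and> norm z \<le> 5/2} u"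
    and curv: "(\<integral>\<^sup>+z\<in>{z. 1/2 \<le> norm z \<and> norm z \<le> 5/2}. ennreal \<bar>laplacian u z\<bar> \<partial>lborel) \<le> ennreal (1/2)"
  obtains \<phi> where "\<And>S. continuous_on S \<phi>" "\<And>r. 0 \<le> \<phi> r" "integral {1..2} (\<lambda>r. exp (2 * \<phi> r)) \<le> 8"
    "\<And>a R. 1 \<le> norm a \<Longrightarrow> norm a \<le> 2 \<Longrightarrow> 0 < R \<Longrightarrow> R \<le> 1/2 \<Longrightarrow>
       \<bar>integral {0..2*pi} (\<lambda>t. u (a + of_real R * cis t)) - 2 * pi * u a\<bar> \<le> 2 * pi * \<phi> (norm a)"
proof -
  let ?K = "{z. 1/2 \<le> norm z \<and> norm z \<le> 5/2} :: complex set"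
  let ?L = "{z. 1/2 \<le> norm (z - 0) \<and> norm (z - 0) \<le> 5/2} :: complex set"
  have cL: "continuous_on ?L (\<lambda>z. \<bar>laplacian u z\<bar>)"
    using continuous_on_rabs[OF continuous_on_laplacian[OF u]] by simp
  define q where "q s = s * integral {0..2*pi} (\<lambda>t. \<bar>laplacian u (0 + of_real s * cis t)\<bar>)" for s
  have cq: "continuous_on {1/2..5/2} q"
    unfolding q_def by (intro continuous_on_mult continuous_on_id continuous_on_circle_integral[OF cL]) auto
  have q0: "0 \<le> q s" if "s \<in> {1/2..5/2}" for s
    unfolding q_def using that
    by (intro mult_nonneg_nonneg integral_nonneg integrable_continuous_interval continuous_on_circle[OF cL]) auto
  \<comment> \<open>Clamping the radius extends \<open>q\<close> from \<open>{1/2..5/2}\<close> to a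
    bounded continuous function on the line, as the assumptions on \<open>h\<close> are
    global.\<close>
  define cl where "cl s = max (1/2) (min (5/2) s)" for s :: real
  have cl: "cl s \<in> {1/2..5/2}" for s by (auto simp: cl_def)
  have cl_id: "s \<in> {1/2..5/2} \<Longrightarrow> cl s = s" for s by (auto simp: cl_def)
  \<comment> \<open>Adding \<open>1/16\<close> keeps the mass of \<open>h\<close> away from zero, as Jensen's inequality requires.\<close>
  define h where "h s = q (cl s) / (2 * pi) + 1/16" for s
  obtain Q where "\<forall>y\<in>q ` {1/2..5/2}. norm y \<le> Q"
    using compact_imp_bounded[OF compact_continuous_image[OF cq compact_Icc]]
    unfolding bounded_iff by blast
  then have Q: "\<bar>q s\<bar> \<le> Q" if "s \<in> {1/2..5/2}" for s using that by fastforce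
  have ch: "continuous_on UNIV h"
  proof -
    have "continuous_on UNIV (\<lambda>s. q (cl s))"
      by (rule continuous_on_compose2[OF cq]) (use cl in \<open>auto simp: cl_def intro!: continuous_intros\<close>)
    then show ?thesis unfolding h_def by (intro continuous_intros) auto
  qed
  have h_lower: "1/16 \<le> h s" for s
    using q0[OF cl] by (simp add: h_def)
  have h_upper: "h s \<le> Q / (2 * pi) + 1/16" for s
    using Q[OF cl, of s] by (simp add: h_def divide_right_mono)
  have polar: "(\<integral>\<^sup>+z\<in>?K. ennreal (k (norm z) * \<bar>laplacian u z\<bar>) \<partial>lborel)
      = (\<integral>\<^sup>+s\<in>{1/2..5/2}. ennreal (k s * q s) \<partial>lborel)"
    if "k \<in> borel_measurable borel" "\<And>r. 0 \<le> k r" for k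
    using nn_integral_polar_annulus[OF cL abs_ge_zero that] unfolding q_def by simp
  have mass: "(\<integral>\<^sup>+s\<in>{1/2..5/2}. ennreal (h s) \<partial>lborel) \<le> ennreal (1/4)"
  proof -
    have "ennreal (integral {1/2..5/2} q) = (\<integral>\<^sup>+s\<in>{1/2..5/2}. ennreal (1 * q s) \<partial>lborel)"
      using ennreal_integral_Icc[OF cq q0] by simp
    also have "\<dots> = (\<integral>\<^sup>+z\<in>?K. ennreal (1 * \<bar>laplacian u z\<bar>) \<partial>lborel)"
      by (rule polar[symmetric]) auto
    also have "\<dots> \<le> ennreal (1/2)" using curv by simp
    finally have q: "integral {1/2..5/2} q \<le> 1/2" by (subst (asm) ennreal_le_iff) auto
    have "(\<integral>\<^sup>+s\<in>{1/2..5/2}. ennreal (h s) \<partial>lborel) = ennreal (integral {1/2..5/2} h)"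
      using h_lower by (intro ennreal_integral_Icc continuous_on_subset[OF ch])
        (auto intro: order.trans[of 0 "1/16"])
    also have "integral {1/2..5/2} h = integral {1/2..5/2} (\<lambda>s. q s / (2 * pi) + 1/16)"
      by (intro integral_cong) (simp add: h_def cl_id)
    also have "\<dots> = integral {1/2..5/2} q / (2 * pi) + 1/8"
      by (subst integral_add) (auto intro!: integrable_continuous_interval continuous_intros cq)
    also have "ennreal \<dots> \<le> ennreal (1/4)"
    proof (rule ennreal_leI)
      \<comment> \<open>Half of the allowed mass 1/4 goes to the Laplacian, estimated with pi \<ge>
        2, and half to the constant 1/16 on an interval of length 2.\<close>
      have "integral {1/2..5/2} q / (2 * pi) \<le> (1/2) / (2 * 2)"
        using q pi_ge_two by (intro frac_le) auto
      also have "(1/2) / (2 * 2) = (1/8 :: real)" by simp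
      finally show "integral {1/2..5/2} q / (2 * pi) + 1/8 \<le> 1/4" by linarith
    qed
    finally show ?thesis .
  qed
  note pot = ch h_lower h_upper mass
  have [measurable]: "h \<in> borel_measurable borel" by (rule borel_measurable_continuous_onI[OF ch])
  show ?thesis
  proof (rule that[of "log_potential h"])
    show "continuous_on S (log_potential h)" for S by (rule continuous_on_log_potential[OF pot])
    show "0 \<le> log_potential h r" for r by (rule log_potential_nonneg[OF pot])
    show "integral {1..2} (\<lambda>r. exp (2 * log_potential h r)) \<le> 8"
      by (rule integral_exp_log_potential_le[OF pot])
    fix a :: complex and R :: real
    assume a: "1 \<le> norm a" "norm a \<le> 2" and R: "0 < R" "R \<le> 1/2"
    let ?k = "\<lambda>s. log_kernel (s - norm a)"
    note sub = cball_subset_annulus[OF a R(2)]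
    have "ennreal \<bar>integral {0..2*pi} (\<lambda>t. u (a + of_real R * cis t)) - 2 * pi * u a\<bar>
        \<le> (\<integral>\<^sup>+z\<in>cball a R. ennreal (ln (R / norm (z - a)) * \<bar>laplacian u z\<bar>) \<partial>lborel)"
      by (rule norm_circle_mean_diff_le[OF smooth_on_subset[OF u sub] R(1)])
    also have "\<dots> \<le> (\<integral>\<^sup>+z\<in>?K. ennreal (?k (norm z) * \<bar>laplacian u z\<bar>) \<partial>lborel)"
    proof (rule nn_integral_mono_AE, rule AE_mp[OF AE_lborel_norm_neq[of "norm a"]], intro AE_I2 impI)
      fix z :: complex assume z: "norm z \<noteq> norm a"
      show "ennreal (ln (R / norm (z - a)) * \<bar>laplacian u z\<bar>) * indicator (cball a R) z
          \<le> ennreal (?k (norm z) * \<bar>laplacian u z\<bar>) * indicator ?K z"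
      proof (cases "z \<in> cball a R")
        case True
        have "z \<in> ?K" by (rule subsetD[OF sub True])
        moreover have "ennreal (ln (R / norm (z - a)) * \<bar>laplacian u z\<bar>) \<le> ennreal (?k (norm z) * \<bar>laplacian u z\<bar>)"
          using ln_quotient_le_log_kernel[OF z R] by (intro ennreal_leI mult_right_mono) simp_all
        ultimately show ?thesis using True by (simp only: indicator_simps mult_1_right)
      qed simp
    qed
    also have "\<dots> = (\<integral>\<^sup>+s\<in>{1/2..5/2}. ennreal (?k s * q s) \<partial>lborel)"
      by (rule polar) (simp_all add: log_kernel_nonneg)
    also have "\<dots> \<le> (\<integral>\<^sup>+s. ennreal (2 * pi) * (ennreal (?k s * h s) * indicator {-1/2..1/2} (s - norm a)) \<partial>lborel)"
    proof (rule nn_integral_mono)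
      fix s
      show "ennreal (?k s * q s) * indicator {1/2..5/2} s
        \<le> ennreal (2 * pi) * (ennreal (?k s * h s) * indicator {-1/2..1/2} (s - norm a))"
      proof (cases "s \<in> {1/2..5/2} \<and> s - norm a \<in> {-1/2..1/2}")
        case True
        have "q s \<le> 2 * pi * h s" using True by (simp add: h_def cl_id field_simps)
        then have "?k s * q s \<le> 2 * pi * (?k s * h s)"
          using mult_left_mono[OF _ log_kernel_nonneg, of "q s" "2 * pi * h s" "s - norm a"] by (simp add: mult_ac)
        then have "ennreal (?k s * q s) \<le> ennreal (2 * pi) * ennreal (?k s * h s)"
          by (subst ennreal_mult'[symmetric]) (auto intro!: ennreal_leI)
        then show ?thesis using True by simp
      next
        case False
        then have "s \<notin> {1/2..5/2} \<or> ?k s = 0" using log_kernel_eq_0 by blast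
        then show ?thesis by auto
      qed
    qed
    also have "\<dots> = ennreal (2 * pi) * (\<integral>\<^sup>+s. ennreal (?k s * h s) * indicator {-1/2..1/2} (s - norm a) \<partial>lborel)"
      by (rule nn_integral_cmult) measurable
    also have "(\<integral>\<^sup>+s. ennreal (?k s * h s) * indicator {-1/2..1/2} (s - norm a) \<partial>lborel)
        = (\<integral>\<^sup>+x\<in>{-1/2..1/2}. ennreal (log_kernel x * h (norm a + x)) \<partial>lborel)"
      by (subst nn_integral_real_affine[where c=1 and t="norm a"]) simp_all
    also have "\<dots> = ennreal (log_potential h (norm a))" by (rule ennreal_log_potential[OF pot])
    also have "ennreal (2 * pi) * \<dots> = ennreal (2 * pi * log_potential h (norm a))"
      using log_potential_nonneg[OF pot] by (simp add: ennreal_mult)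
    finally show "\<bar>integral {0..2*pi} (\<lambda>t. u (a + of_real R * cis t)) - 2 * pi * u a\<bar>
        \<le> 2 * pi * log_potential h (norm a)"
      using log_potential_nonneg[OF pot] by (subst (asm) ennreal_le_iff) auto
  qed
qed

text \<open>An integral bound on |u - c| over a disc does not control a single circle. The deviation
  estimate is therefore averaged over all radii R in [0, 1/2] with weight R, which turns the circle
  integrals into the disc integral of |u - c|, to which the Poincare inequality applies.\<close>

lemma conformal_factor_bound:
  assumes u: "smooth_on {z. 1/2 \<le> norm z \<and> norm z \<le> 5/2} u"
    and curv: "(\<integral>\<^sup>+z\<in>{z. 1/2 \<le> norm z \<and> norm z \<le> 5/2}. ennreal \<bar>laplacian u z\<bar> \<partial>lborel) \<le> ennreal (1/2)"
    and grad: "(\<integral>\<^sup>+z\<in>{z. 1/2 \<le> norm z \<and> norm z \<le> 5/2}. ennreal (norm (grad u z)) \<partial>lborel) \<le> ennreal X"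
    and X: "0 \<le> X"
  obtains \<phi> where "\<And>S. continuous_on S \<phi>" "\<And>r. 0 \<le> \<phi> r" "integral {1..2} (\<lambda>r. exp (2 * \<phi> r)) \<le> 8"
    "\<And>z. 1 \<le> norm z \<Longrightarrow> norm z \<le> 2 \<Longrightarrow>
       \<bar>u z - circle_mean u (3/2)\<bar> \<le> 4 / pi * (5 * pi + 10) * X + \<phi> (norm z)"
proof -
  let ?K = "{z. 1/2 \<le> norm z \<and> norm z \<le> 5/2} :: complex set"
  let ?c = "circle_mean u (3/2)"
  obtain \<phi> where \<phi>: "\<And>S. continuous_on S \<phi>" "\<And>r. 0 \<le> \<phi> r" "integral {1..2} (\<lambda>r. exp (2 * \<phi> r)) \<le> 8"
    "\<And>a R. 1 \<le> norm a \<Longrightarrow> norm a \<le> 2 \<Longrightarrow> 0 < R \<Longrightarrow> R \<le> 1/2 \<Longrightarrow>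
       \<bar>integral {0..2*pi} (\<lambda>t. u (a + of_real R * cis t)) - 2 * pi * u a\<bar> \<le> 2 * pi * \<phi> (norm a)"
    using circle_mean_deviation_bound[OF u curv] by blast
  have "\<bar>u a - ?c\<bar> \<le> 4 / pi * (5 * pi + 10) * X + \<phi> (norm a)"
    if a: "1 \<le> norm a" "norm a \<le> 2" for a
  proof -
    let ?B = "{z. 0 \<le> norm (z - a) \<and> norm (z - a) \<le> 1/2}"
    have B: "?B = cball a (1/2)" by (auto simp: dist_norm norm_minus_commute)
    have sub: "?B \<subseteq> ?K" unfolding B by (rule cball_subset_annulus[OF a]) simp
    have cu: "continuous_on ?B (\<lambda>z. \<bar>u z - ?c\<bar>)" "continuous_on ?B u"
      using smooth_on_imp_continuous_on[OF smooth_on_subset[OF u sub]] by (auto intro!: continuous_intros)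
    define W where "W R = integral {0..2*pi} (\<lambda>t. \<bar>u (a + of_real R * cis t) - ?c\<bar>)" for R
    have cW: "continuous_on {0..1/2} (\<lambda>R. R * W R)"
      unfolding W_def by (intro continuous_on_mult continuous_on_id continuous_on_circle_integral[OF cu(1)]) auto
    have iW: "(\<lambda>t. \<bar>u (a + of_real R * cis t) - ?c\<bar>) integrable_on {0..2*pi}" if "R \<in> {0..1/2}" for R
      by (rule integrable_continuous_interval[OF continuous_on_circle[OF cu(1) order_refl that]])
    have W0: "0 \<le> W R" if "R \<in> {0..1/2}" for R
      unfolding W_def by (intro integral_nonneg iW that) simp
    have "ennreal (integral {0..1/2} (\<lambda>R. R * W R)) = (\<integral>\<^sup>+R\<in>{0..1/2}. ennreal (R * W R) \<partial>lborel)"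
      using W0 by (intro ennreal_integral_Icc[symmetric] cW) auto
    also have "\<dots> = (\<integral>\<^sup>+z\<in>?B. ennreal \<bar>u z - ?c\<bar> \<partial>lborel)"
      using nn_integral_polar_annulus[OF cu(1) abs_ge_zero, of "\<lambda>_. 1"] unfolding W_def by simp
    also have "\<dots> \<le> (\<integral>\<^sup>+z\<in>?K. ennreal \<bar>u z - ?c\<bar> \<partial>lborel)"
      using sub by (intro nn_integral_mono mult_left_mono) (auto simp: indicator_def)
    also have "\<dots> \<le> ennreal (2 * pi * (5/2) + (5/2) * (5/2 - 1/2) / (1/2))
       * (\<integral>\<^sup>+z\<in>?K. ennreal (norm (grad u z)) \<partial>lborel)"
      by (rule poincare_annulus[OF u]) auto
    also have "\<dots> \<le> ennreal (2 * pi * (5/2) + (5/2) * (5/2 - 1/2) / (1/2)) * ennreal X"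
      by (intro mult_left_mono grad) simp
    also have "\<dots> = ennreal ((5 * pi + 10) * X)"
      using X by (subst ennreal_mult[symmetric]) auto
    finally have IW: "integral {0..1/2} (\<lambda>R. R * W R) \<le> (5 * pi + 10) * X"
      using X by (subst (asm) ennreal_le_iff) auto
    have pw: "R * (2 * pi * \<bar>u a - ?c\<bar>) \<le> R * (2 * pi * \<phi> (norm a)) + R * W R" if R: "R \<in> {0..1/2}" for R
    proof (cases "R = 0")
      case False
      with R have R': "0 < R" "R \<le> 1/2" by auto
      have i: "(\<lambda>t. u (a + of_real R * cis t)) integrable_on {0..2*pi}"
        by (rule integrable_continuous_interval[OF continuous_on_circle[OF cu(2) order_refl R]])
      have "integral {0..2*pi} (\<lambda>t. u (a + of_real R * cis t)) - 2 * pi * ?c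
          = integral {0..2*pi} (\<lambda>t. u (a + of_real R * cis t) - ?c)"
        by (subst integral_diff) (use i in auto)
      also have "\<bar>\<dots>\<bar> \<le> W R"
        unfolding W_def by (rule abs_integral_le_integral) (use i iW[OF R] in \<open>auto intro!: integrable_diff\<close>)
      finally have "\<bar>2 * pi * u a - 2 * pi * ?c\<bar> \<le> 2 * pi * \<phi> (norm a) + W R"
        using \<phi>(4)[OF a R'] by linarith
      then have "2 * pi * \<bar>u a - ?c\<bar> \<le> 2 * pi * \<phi> (norm a) + W R"
        unfolding right_diff_distrib[symmetric] abs_mult by simp
      then show ?thesis using R' by (simp add: distrib_left[symmetric])
    qed simp
    \<comment> \<open>The weight has total 1/8, so the left side becomes pi/4 times |u(a) - c|. This
      is the origin of the factor 4 / pi; 5 pi + 10 is the Poincare constant for the radii 1/2 and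
      5/2.\<close>
    have id: "((\<lambda>R::real. R) has_integral 1/8) {0..1/2}"
      using ident_has_integral[of 0 "1/2::real"] by (simp add: power2_eq_square)
    have iRW: "(\<lambda>R. R * W R) integrable_on {0..1/2}" by (rule integrable_continuous_interval[OF cW])
    have "1/8 * (2 * pi * \<bar>u a - ?c\<bar>) \<le> 1/8 * (2 * pi * \<phi> (norm a)) + integral {0..1/2} (\<lambda>R. R * W R)"
      by (rule has_integral_le[OF has_integral_mult_left[OF id]
            has_integral_add[OF has_integral_mult_left[OF id] integrable_integral[OF iRW]]])
        (rule pw)
    with IW have "1/8 * (2 * pi * \<bar>u a - ?c\<bar>) \<le> 1/8 * (2 * pi * \<phi> (norm a)) + (5 * pi + 10) * X" by linarith
    then have "pi * \<bar>u a - ?c\<bar> \<le> 4 * ((5 * pi + 10) * X) + pi * \<phi> (norm a)" by simp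
    also have "4 * ((5 * pi + 10) * X) = (pi * (4 / pi)) * ((5 * pi + 10) * X)" by simp
    also have "\<dots> + pi * \<phi> (norm a) = pi * (4 / pi * (5 * pi + 10) * X + \<phi> (norm a))"
      by (simp only: mult.assoc distrib_left[of pi])
    finally have "pi * \<bar>u a - ?c\<bar> \<le> pi * (4 / pi * (5 * pi + 10) * X + \<phi> (norm a))" .
    then show ?thesis by (rule mult_left_le_imp_le) simp
  qed
  then show ?thesis using that \<phi> by blast
qed

section \<open>Lengths of paths compared with radial weights\<close>

lemma ennreal_abs_has_integral_le:
  fixes f :: "'a::euclidean_space \<Rightarrow> real"
  assumes f: "(f has_integral I) S"
  shows "ennreal \<bar>I\<bar> \<le> (\<integral>\<^sup>+x\<in>S. ennreal \<bar>f x\<bar> \<partial>lborel)"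
proof (cases "(\<integral>\<^sup>+x\<in>S. ennreal \<bar>f x\<bar> \<partial>lborel) = \<infinity>")
  case False
  have m: "(\<lambda>x. indicator S x *\<^sub>R f x) \<in> borel_measurable lebesgue"
    using f by (rule has_integral_implies_lebesgue_measurable)
  have eq: "(\<integral>\<^sup>+x. ennreal (norm (indicator S x *\<^sub>R f x)) \<partial>lebesgue) = (\<integral>\<^sup>+x\<in>S. ennreal \<bar>f x\<bar> \<partial>lborel)"
    unfolding nn_integral_completion by (intro nn_integral_cong) (simp add: indicator_def)
  \<comment> \<open>Finiteness of the right side upgrades a possibly conditionally convergent gauge
    integral to an absolutely convergent one. This matters for paths whose derivative is unbounded
    near break points.\<close>
  have a: "f absolutely_integrable_on S"
    unfolding set_integrable_def using m eq False by (intro integrableI_bounded) (auto simp: less_top)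
  then have i: "(\<lambda>x. \<bar>f x\<bar>) integrable_on S" "f integrable_on S"
    unfolding absolutely_integrable_on_def by auto
  have "\<bar>I\<bar> \<le> integral S (\<lambda>x. \<bar>f x\<bar>)"
    using abs_integral_le_integral[OF i(2) i(1)] integral_unique[OF f] by simp
  then have "ennreal \<bar>I\<bar> \<le> ennreal (integral S (\<lambda>x. \<bar>f x\<bar>))" by (rule ennreal_leI)
  also have "\<dots> = (\<integral>\<^sup>+x\<in>S. ennreal \<bar>f x\<bar> \<partial>lborel)"
    by (rule nn_integral_has_integral_lebesgue'[symmetric, OF _ integrable_integral[OF i(1)]]) simp
  finally show ?thesis .
qed simp

text \<open>If F is a primitive of w, then F(|\<gamma>|) changes at a rate of at most w(|\<gamma>|)
  |\<gamma>'| \<le> exp (u(\<gamma>)) |\<gamma>'|. The radius may go back and forth and leave the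
  interval between its end values, since the weight is given at all radii. Avoiding 0 keeps the norm
  differentiable along the path.\<close>

lemma conf_length_ge:
  fixes w :: "real \<Rightarrow> real"
  assumes w: "continuous_on UNIV w" "\<And>r. 0 \<le> w r"
    and \<gamma>: "valid_path \<gamma>" "0 \<notin> path_image \<gamma>"
    and r: "norm (pathstart \<gamma>) \<le> norm (pathfinish \<gamma>)"
    and u: "\<And>z. w (norm z) \<le> exp (u z)"
  shows "ennreal (integral {norm (pathstart \<gamma>)..norm (pathfinish \<gamma>)} w) \<le> conf_length u \<gamma>"
proof -
  obtain S where cont: "continuous_on {0..1} \<gamma>" and S: "finite S" "\<gamma> C1_differentiable_on ({0..1} - S)"
    using \<gamma>(1) unfolding valid_path_def piecewise_C1_differentiable_on_def by blast
  have nz: "\<gamma> t \<noteq> 0" if "t \<in> {0..1}" for t using \<gamma>(2) that by (auto simp: path_image_def)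
  \<comment> \<open>The bound is strict so that every |\<gamma> t| lies in the interior of [0, b],
    where \<open>F\<close> has a two-sided derivative.\<close>
  obtain b where "\<forall>z\<in>\<gamma> ` {0..1}. norm z < b"
    using compact_imp_bounded[OF compact_continuous_image[OF cont compact_Icc]]
    unfolding bounded_pos_less by blast
  then have b: "norm (\<gamma> t) < b" if "t \<in> {0..1}" for t using that by blast
  define F where "F x = integral {0..x} w" for x
  have F': "(F has_real_derivative w x) (at x within {0..b})" if "x \<in> {0..b}" for x
    unfolding F_def using integral_has_real_derivative[OF continuous_on_subset[OF w(1) subset_UNIV] that] .
  have cF: "continuous_on {0..b} F"
    using F' by (meson DERIV_continuous continuous_on_eq_continuous_within)
  let ?d = "\<lambda>t. w (norm (\<gamma> t)) * (sgn (\<gamma> t) \<bullet> vector_derivative \<gamma> (at t))"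
  have "(?d has_integral (F (norm (\<gamma> 1)) - F (norm (\<gamma> 0)))) {0..1}"
  proof (rule fundamental_theorem_of_calculus_interior_strong[OF S(1)])
    show "continuous_on {0..1} (\<lambda>t. F (norm (\<gamma> t)))"
      by (rule continuous_on_compose2[OF cF]) (use b in \<open>auto intro!: continuous_intros cont simp: less_imp_le\<close>)
    fix t assume t: "t \<in> {0<..<1} - S"
    then have \<gamma>': "(\<gamma> has_vector_derivative vector_derivative \<gamma> (at t)) (at t)"
      using S(2) by (auto simp: C1_differentiable_on_eq vector_derivative_works)
    have "((\<lambda>t. norm (\<gamma> t)) has_derivative (\<lambda>x. sgn (\<gamma> t) \<bullet> (x *\<^sub>R vector_derivative \<gamma> (at t)))) (at t)"
      using has_derivative_compose[OF \<gamma>'[unfolded has_vector_derivative_def] has_derivative_norm] nz t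
      by (auto simp: inner_commute)
    then have n': "((\<lambda>t. norm (\<gamma> t)) has_real_derivative sgn (\<gamma> t) \<bullet> vector_derivative \<gamma> (at t)) (at t)"
      unfolding has_field_derivative_def by (rule has_derivative_eq_rhs) (auto simp: fun_eq_iff)
    have pos: "norm (\<gamma> t) \<in> {0<..<b}" using nz b t by auto
    then have "at (norm (\<gamma> t)) within {0..b} = at (norm (\<gamma> t))"
      by (intro at_within_interior) (simp add: interior_atLeastAtMost_real)
    then have "(F has_real_derivative w (norm (\<gamma> t))) (at (norm (\<gamma> t)))"
      using F'[of "norm (\<gamma> t)"] pos by auto
    from DERIV_chain2[OF this n']
    show "((\<lambda>t. F (norm (\<gamma> t))) has_vector_derivative ?d t) (at t)"
      by (simp add: has_real_derivative_iff_has_vector_derivative)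
  qed simp
  from ennreal_abs_has_integral_le[OF this]
  have "ennreal \<bar>F (norm (\<gamma> 1)) - F (norm (\<gamma> 0))\<bar> \<le> (\<integral>\<^sup>+t\<in>{0..1}. ennreal \<bar>?d t\<bar> \<partial>lborel)" .
  also have "\<dots> \<le> conf_length u \<gamma>"
    unfolding conf_length_def
  proof (intro nn_integral_mono mult_right_mono ennreal_leI)
    fix t
    have "\<bar>sgn (\<gamma> t) \<bullet> vector_derivative \<gamma> (at t)\<bar> \<le> norm (sgn (\<gamma> t)) * norm (vector_derivative \<gamma> (at t))"
      by (rule Cauchy_Schwarz_ineq2)
    also have "\<dots> \<le> 1 * norm (vector_derivative \<gamma> (at t))"
      by (intro mult_right_mono) (auto simp: norm_sgn)
    finally show "\<bar>?d t\<bar> \<le> exp (u (\<gamma> t)) * norm (vector_derivative \<gamma> (at t))"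
      unfolding abs_mult using u[of "\<gamma> t"] w(2) by (intro mult_mono) auto
  qed simp
  finally have "ennreal \<bar>F (norm (\<gamma> 1)) - F (norm (\<gamma> 0))\<bar> \<le> conf_length u \<gamma>" .
  moreover have "F (norm (\<gamma> 1)) - F (norm (\<gamma> 0)) = integral {norm (\<gamma> 0)..norm (\<gamma> 1)} w"
  proof -
    have "integral {0..norm (\<gamma> 0)} w + integral {norm (\<gamma> 0)..norm (\<gamma> 1)} w = integral {0..norm (\<gamma> 1)} w"
      using r by (intro Henstock_Kurzweil_Integration.integral_combine integrable_continuous_interval continuous_on_subset[OF w(1)])
        (auto simp: pathstart_def pathfinish_def)
    then show ?thesis by (simp add: F_def)
  qed
  moreover have "0 \<le> integral {norm (\<gamma> 0)..norm (\<gamma> 1)} w"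
    using w by (intro integral_nonneg integrable_continuous_interval continuous_on_subset[OF w(1)]) auto
  ultimately show ?thesis by (simp add: pathstart_def pathfinish_def)
qed

text \<open>With y = exp x the left side is the tangent to 1 / y at y = a, and 1 / y is convex. The
  free point \<open>a\<close> is chosen at each use to make the resulting lower bound best.\<close>

lemma exp_minus_tangent: "0 < a \<Longrightarrow> 2 / a - exp x / a\<^sup>2 \<le> exp (- x :: real)"
proof -
  assume a: "0 < a"
  define y where "y = exp (x/2)"
  have y: "0 < y" "exp x = y\<^sup>2" "exp (- x) = 1 / y\<^sup>2"
    by (simp_all add: y_def exp_minus power2_eq_square inverse_eq_divide flip: exp_add)
  have "0 \<le> (y / a - 1 / y)\<^sup>2" by simp
  also have "\<dots> = exp x / a\<^sup>2 - 2 / a + exp (- x)"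
    using a y by (simp add: power2_diff power_divide)
  finally show ?thesis by simp
qed

subsection \<open>Distance and area\<close>

lemma conf_dist_lower_bound:
  assumes \<phi>: "continuous_on UNIV \<phi>" "\<And>r. 0 \<le> \<phi> r" "integral {1..2} (\<lambda>r. exp (2 * \<phi> r)) \<le> 8"
    and u: "\<And>z. 1 \<le> norm z \<Longrightarrow> norm z \<le> 2 \<Longrightarrow> c - B - \<phi> (norm z) \<le> u z"
    and A: "0 \<notin> A" and x: "norm x = 1" and y: "norm y = 2"
  shows "ennreal (exp (c - B) / 72) \<le> conf_dist A u x y"
proof -
  have c\<phi>: "continuous_on S \<phi>" for S by (rule continuous_on_subset[OF \<phi>(1) subset_UNIV])
  \<comment> \<open>The factor \<open>(r - 1) * (2 - r)\<close> makes \<open>w\<close> continuous when extended by zero, so a path may leave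
    the annulus.\<close>
  define w where "w r = exp (c - B) * (max 0 ((r - 1) * (2 - r)) * exp (- \<phi> r))" for r
  have cw: "continuous_on S w" for S unfolding w_def by (intro continuous_intros c\<phi>)
  have w0: "0 \<le> w r" for r by (simp add: w_def)
  have wu: "w (norm z) \<le> exp (u z)" for z
  proof (cases "1 \<le> norm z \<and> norm z \<le> 2")
    case True
    have "(norm z - 1) * (2 - norm z) \<le> 1 * 1" using True by (intro mult_mono) auto
    then have "w (norm z) \<le> exp (c - B) * (1 * exp (- \<phi> (norm z)))"
      unfolding w_def by (intro mult_left_mono mult_right_mono) auto
    also have "\<dots> \<le> exp (u z)" using u[of z] True by (simp add: exp_add[symmetric])
    finally show ?thesis .
  next
    case False
    then have "(norm z - 1) * (2 - norm z) \<le> 0" by (auto simp: mult_le_0_iff)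
    then show ?thesis by (simp add: w_def max_def)
  qed
  have "exp (c - B) / 72 \<le> integral {1..2} w"
  proof -
    let ?p = "\<lambda>r::real. (r - 1) * (2 - r)"
    have p: "(?p has_integral (1/6)) {1..2}"
    proof -
      have "(?p has_integral ((3/2 * 2^2 - 2^3/3 - 2*2) - (3/2 * 1^2 - 1^3/3 - 2*1))) {1..2}"
      proof (rule fundamental_theorem_of_calculus)
        fix x :: real
        show "((\<lambda>r. 3/2 * r^2 - r^3/3 - 2*r) has_vector_derivative ?p x) (at x within {1..2})"
          unfolding has_real_derivative_iff_has_vector_derivative[symmetric]
          by (auto intro!: derivative_eq_intros simp: power2_eq_square algebra_simps)
      qed simp
      then show ?thesis by simp
    qed
    have i: "(\<lambda>r. exp (2 * \<phi> r)) integrable_on {1..2}"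
      by (intro integrable_continuous_interval continuous_intros c\<phi>)
    have aux: "P * (1/6) - E * (1/576) \<le> P * (2 / 12 - e / 12\<^sup>2)" if "P * e \<le> 1/4 * E" for P e E :: real
      using that by (simp add: algebra_simps)
    \<comment> \<open>The tangent is taken at a = 12. Since \<open>?p\<close> has integral 1/6 and
      is at most 1/4, a general a gives 1 / (3 a) - 2 / a^2, which is largest at 12 with value 1/36
      - 1/72 = 1/72.\<close>
    have "1/6 * (1/6) - integral {1..2} (\<lambda>r. exp (2 * \<phi> r)) * (1/576) \<le> integral {1..2} (\<lambda>r. max 0 (?p r) * exp (- \<phi> r))"
    proof (rule has_integral_le[OF has_integral_diff[OF has_integral_mult_left[OF p] has_integral_mult_left[OF integrable_integral[OF i]]]
          integrable_integral])
      show "(\<lambda>r. max 0 (?p r) * exp (- \<phi> r)) integrable_on {1..2}"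
        by (intro integrable_continuous_interval continuous_intros c\<phi>)
      fix r :: real assume r: "r \<in> {1..2}"
      have p0: "0 \<le> ?p r" using r by simp
      have "0 \<le> (r - 3/2)\<^sup>2" by simp
      then have p4: "?p r \<le> 1/4" by (simp add: power2_eq_square algebra_simps)
      \<comment> \<open>Nonnegativity of \<phi> lets the integral bound for exp (2\<phi>), which is
        the one the area requires, serve for lengths too.\<close>
      have e: "exp (\<phi> r) \<le> exp (2 * \<phi> r)" using \<phi>(2)[of r] by simp
      have "?p r * exp (\<phi> r) \<le> 1/4 * exp (2 * \<phi> r)" using p0 p4 e by (intro mult_mono) auto
      then have "?p r * (1/6) - exp (2 * \<phi> r) * (1/576) \<le> ?p r * (2 / 12 - exp (\<phi> r) / 12\<^sup>2)"
        by (rule aux)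
      also have "\<dots> \<le> ?p r * exp (- \<phi> r)"
        using p0 by (intro mult_left_mono exp_minus_tangent) auto
      finally show "?p r * (1/6) - exp (2 * \<phi> r) * (1/576) \<le> max 0 (?p r) * exp (- \<phi> r)"
        using p0 by (simp add: max_def)
    qed
    with \<phi>(3) have "1/72 \<le> integral {1..2} (\<lambda>r. max 0 (?p r) * exp (- \<phi> r))" by linarith
    from mult_left_mono[OF this, of "exp (c - B)"] show ?thesis
      unfolding w_def integral_mult_right by simp
  qed
  then have "ennreal (exp (c - B) / 72) \<le> ennreal (integral {1..2} w)" by (rule ennreal_leI)
  also have "\<dots> \<le> conf_dist A u x y"
    unfolding conf_dist_def
  proof (rule INF_greatest)
    fix \<gamma> assume "\<gamma> \<in> {\<gamma>. valid_path \<gamma> \<and> path_image \<gamma> \<subseteq> A \<and> pathstart \<gamma> = x \<and> pathfinish \<gamma> = y}"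
    then show "ennreal (integral {1..2} w) \<le> conf_length u \<gamma>"
      using conf_length_ge[OF cw w0, of \<gamma> u] wu A x y by auto
  qed
  finally show ?thesis .
qed

lemma conf_dist_upper_bound:
  assumes \<phi>: "continuous_on UNIV \<phi>" "\<And>r. 0 \<le> \<phi> r" "integral {1..2} (\<lambda>r. exp (2 * \<phi> r)) \<le> 8"
    and u: "\<And>z. 1 \<le> norm z \<Longrightarrow> norm z \<le> 2 \<Longrightarrow> u z \<le> c + B + \<phi> (norm z)"
    and A: "{z. 1 \<le> norm z \<and> norm z \<le> 2} \<subseteq> A"
  shows "conf_dist A u (cis \<theta>) (2 * cis \<theta>') \<le> ennreal ((1 + 4 * pi) * 8 * exp (c + B))"
proof -
  have c\<phi>: "continuous_on S \<phi>" for S by (rule continuous_on_subset[OF \<phi>(1) subset_UNIV])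
  \<comment> \<open>A spiral meets each circle once, which suffices because \<open>\<phi>\<close> depends on the radius only.\<close>
  define n where "n = \<lfloor>(\<theta>' - \<theta>) / (2 * pi)\<rfloor>"
  define \<delta> where "\<delta> = \<theta>' - \<theta> - 2 * pi * of_int n"
  have \<delta>: "0 \<le> \<delta>" "\<delta> \<le> 2 * pi"
  proof -
    have "of_int n \<le> (\<theta>' - \<theta>) / (2 * pi)" "(\<theta>' - \<theta>) / (2 * pi) < of_int n + 1"
      unfolding n_def by linarith+
    then show "0 \<le> \<delta>" "\<delta> \<le> 2 * pi" unfolding \<delta>_def by (simp_all add: field_simps)
  qed
  have end_: "cis (\<theta> + \<delta>) = cis \<theta>'"
  proof -
    have "cis (\<theta> + \<delta>) = cis (\<theta>' - 2 * pi * of_int n)" by (simp add: \<delta>_def)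
    also have "\<dots> = cis \<theta>'" by (simp add: cis_divide[symmetric] cis_multiple_2pi)
    finally show ?thesis .
  qed
  define \<gamma> where "\<gamma> t = of_real (1 + t) * cis (\<theta> + t * \<delta>)" for t
  define \<gamma>' where "\<gamma>' t = cis (\<theta> + t * \<delta>) + of_real ((1 + t) * \<delta>) * (\<i> * cis (\<theta> + t * \<delta>))" for t
  have dv: "(\<gamma> has_vector_derivative \<gamma>' t) (at t)" for t
    unfolding \<gamma>_def \<gamma>'_def cis_conv_exp
    by (auto intro!: derivative_eq_intros has_vector_derivative_real_field simp: algebra_simps)
  have "continuous_on {0..1} \<gamma>'" unfolding \<gamma>'_def by (intro continuous_intros)
  then have "\<gamma> C1_differentiable_on {0..1}"
    unfolding C1_differentiable_on_def using dv by blast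
  then have "valid_path \<gamma>"
    unfolding valid_path_def by (rule C1_differentiable_imp_piecewise)
  moreover have n\<gamma>: "norm (\<gamma> t) = 1 + t" if "t \<in> {0..1}" for t
    using that by (simp add: \<gamma>_def norm_mult del: of_real_add)
  ultimately have "\<gamma> \<in> {\<gamma>. valid_path \<gamma> \<and> path_image \<gamma> \<subseteq> A \<and> pathstart \<gamma> = cis \<theta> \<and> pathfinish \<gamma> = 2 * cis \<theta>'}"
    using A end_ by (auto simp: path_image_def pathstart_def pathfinish_def) (auto simp: \<gamma>_def)
  then have "conf_dist A u (cis \<theta>) (2 * cis \<theta>') \<le> conf_length u \<gamma>"
    unfolding conf_dist_def by (rule INF_lower)
  also have "\<dots> \<le> (\<integral>\<^sup>+t\<in>{0..1}. ennreal (exp (c + B) * (1 + 4 * pi) * exp (2 * \<phi> (1 + t))) \<partial>lborel)"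
    unfolding conf_length_def
  proof (rule nn_integral_mono)
    fix t
    show "ennreal (exp (u (\<gamma> t)) * norm (vector_derivative \<gamma> (at t))) * indicator {0..1} t
      \<le> ennreal (exp (c + B) * (1 + 4 * pi) * exp (2 * \<phi> (1 + t))) * indicator {0..1} t"
    proof (cases "t \<in> {0..1}")
      case True
      \<comment> \<open>The radial speed is 1; the angular one is the radius, at most 2, times an
        angle of at most 2 pi.\<close>
      have "norm (\<gamma>' t) \<le> 1 + (1 + t) * \<delta>"
        unfolding \<gamma>'_def by (rule norm_triangle_le) (use True \<delta> in \<open>simp add: norm_mult del: of_real_mult of_real_add\<close>)
      also have "(1 + t) * \<delta> \<le> 2 * (2 * pi)" using True \<delta> by (intro mult_mono) auto
      finally have 1: "norm (\<gamma>' t) \<le> 1 + 4 * pi" by simp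
      have "u (\<gamma> t) \<le> c + B + 2 * \<phi> (1 + t)"
        using u[of "\<gamma> t"] n\<gamma>[OF True] \<phi>(2)[of "1 + t"] True by simp
      then have 2: "exp (u (\<gamma> t)) \<le> exp (c + B) * exp (2 * \<phi> (1 + t))" by (simp add: exp_add[symmetric])
      have "exp (u (\<gamma> t)) * norm (\<gamma>' t) \<le> (exp (c + B) * exp (2 * \<phi> (1 + t))) * (1 + 4 * pi)"
        using 1 2 by (intro mult_mono) auto
      then show ?thesis using True vector_derivative_at[OF dv]
        by (auto intro!: ennreal_leI simp: mult_ac)
    qed simp
  qed
  also have "\<dots> = (\<integral>\<^sup>+r\<in>{1..2}. ennreal (exp (c + B) * (1 + 4 * pi) * exp (2 * \<phi> r)) \<partial>lborel)"
  proof -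
    have [measurable]: "\<phi> \<in> borel_measurable borel" by (rule borel_measurable_continuous_onI[OF \<phi>(1)])
    show ?thesis
      by (subst (2) nn_integral_real_affine[where c=1 and t=1]) (auto intro!: nn_integral_cong simp: indicator_def)
  qed
  also have "\<dots> = ennreal (integral {1..2} (\<lambda>r. exp (c + B) * (1 + 4 * pi) * exp (2 * \<phi> r)))"
    by (intro ennreal_integral_Icc continuous_intros c\<phi>) auto
  also have "\<dots> \<le> ennreal ((1 + 4 * pi) * 8 * exp (c + B))"
    using mult_left_mono[OF \<phi>(3), of "exp (c + B) * (1 + 4 * pi)"]
    by (intro ennreal_leI) (simp add: mult_ac)
  finally show ?thesis .
qed

lemma conf_area_bounds:
  assumes \<phi>: "continuous_on UNIV \<phi>" "integral {1..2} (\<lambda>r. exp (2 * \<phi> r)) \<le> 8"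
    and u: "\<And>z. 1 \<le> norm z \<Longrightarrow> norm z \<le> 2 \<Longrightarrow> \<bar>u z - c\<bar> \<le> B + \<phi> (norm z)"
  shows "ennreal (pi / 4 * exp (2 * c - 2 * B)) \<le> conf_area u (ball 0 2 - ball 0 1)"
    and "conf_area u (ball 0 2 - ball 0 1) \<le> ennreal (32 * pi * exp (2 * c + 2 * B))"
proof -
  let ?A = "{z. 1 \<le> norm (z - 0) \<and> norm (z - 0) \<le> 2} :: complex set"
  have c\<phi>: "continuous_on S \<phi>" for S by (rule continuous_on_subset[OF \<phi>(1) subset_UNIV])
  have m: "\<phi> \<in> borel_measurable borel" by (rule borel_measurable_continuous_onI[OF \<phi>(1)])
  \<comment> \<open>The difference of open balls contains the inner circle but not the outer one;
    the outer circle is null.\<close>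
  have area: "conf_area u (ball 0 2 - ball 0 1) = (\<integral>\<^sup>+z\<in>?A. ennreal (exp (2 * u z)) \<partial>lborel)"
    unfolding conf_area_def
    by (rule nn_integral_cong_AE, rule AE_mp[OF AE_lborel_norm_neq[of 2]]) (auto simp: indicator_def intro!: AE_I2)
  have polar: "(\<integral>\<^sup>+z\<in>?A. ennreal (exp (s * \<phi> (norm (z - 0))) * d) \<partial>lborel)
      = ennreal (integral {1..2} (\<lambda>r. exp (s * \<phi> r) * (r * (2 * pi * d))))" if d: "0 \<le> d" for s d
  proof -
    have "(\<integral>\<^sup>+z\<in>?A. ennreal (exp (s * \<phi> (norm (z - 0))) * d) \<partial>lborel)
      = (\<integral>\<^sup>+r\<in>{1..2}. ennreal (exp (s * \<phi> r) * (r * integral {0..2*pi} (\<lambda>t. d))) \<partial>lborel)"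
      using nn_integral_polar_annulus[of 1 0 2 "\<lambda>_. d" "\<lambda>r. exp (s * \<phi> r)"] m d by simp
    also have "\<dots> = ennreal (integral {1..2} (\<lambda>r. exp (s * \<phi> r) * (r * (2 * pi * d))))"
      using d by (subst ennreal_integral_Icc) (auto intro!: continuous_intros c\<phi>)
    finally show ?thesis .
  qed
  have i: "(\<lambda>r. exp (2 * \<phi> r)) integrable_on {1..2}"
    by (intro integrable_continuous_interval continuous_intros c\<phi>)
  let ?d = "exp (2 * c - 2 * B)"
  have "pi / 4 * ?d \<le> integral {1..2} (\<lambda>r. exp (-2 * \<phi> r) * (r * (2 * pi * ?d)))"
  proof -
    \<comment> \<open>The tangent at a = 8 maximises 2 / a - 8 / a^2, with value 1/8; multiplied by
      2 pi this is the constant pi / 4. The polar factor r is bounded below by 1.\<close>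
    have "(2 * pi * ?d) * (1/4 - integral {1..2} (\<lambda>r. exp (2 * \<phi> r)) / 64)
        \<le> integral {1..2} (\<lambda>r. exp (-2 * \<phi> r) * (r * (2 * pi * ?d)))"
    proof (rule has_integral_le)
      have "((\<lambda>r::real. 1/4::real) has_integral 1/4) {1..2}"
        using has_integral_const_real[of "1/4::real" 1 2] by simp
      from has_integral_mult_right[OF has_integral_diff[OF this has_integral_divide[OF integrable_integral[OF i], of 64]]]
      show "((\<lambda>r. (2 * pi * ?d) * (1/4 - exp (2 * \<phi> r) / 64)) has_integral
          (2 * pi * ?d) * (1/4 - integral {1..2} (\<lambda>r. exp (2 * \<phi> r)) / 64)) {1..2}" .
      show "((\<lambda>r. exp (-2 * \<phi> r) * (r * (2 * pi * ?d))) has_integral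
          integral {1..2} (\<lambda>r. exp (-2 * \<phi> r) * (r * (2 * pi * ?d)))) {1..2}"
        by (intro integrable_integral integrable_continuous_interval continuous_intros c\<phi>)
      fix r :: real assume r: "r \<in> {1..2}"
      have "1/4 - exp (2 * \<phi> r) / 64 \<le> exp (- 2 * \<phi> r)"
        using exp_minus_tangent[of 8 "2 * \<phi> r"] by simp
      also have "\<dots> \<le> exp (- 2 * \<phi> r) * r" using r by simp
      finally have "(2 * pi * ?d) * (1/4 - exp (2 * \<phi> r) / 64) \<le> (2 * pi * ?d) * (exp (- 2 * \<phi> r) * r)"
        by (rule mult_left_mono) simp
      then show "(2 * pi * ?d) * (1/4 - exp (2 * \<phi> r) / 64) \<le> exp (-2 * \<phi> r) * (r * (2 * pi * ?d))"
        by (simp only: mult_ac)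
    qed
    moreover have "(2 * pi * ?d) * (1/8) \<le> (2 * pi * ?d) * (1/4 - integral {1..2} (\<lambda>r. exp (2 * \<phi> r)) / 64)"
      using \<phi>(2) by (intro mult_left_mono) auto
    ultimately show ?thesis by linarith
  qed
  then have "ennreal (pi / 4 * ?d) \<le> ennreal (integral {1..2} (\<lambda>r. exp (-2 * \<phi> r) * (r * (2 * pi * ?d))))"
    by (rule ennreal_leI)
  also have "\<dots> = (\<integral>\<^sup>+z\<in>?A. ennreal (exp (-2 * \<phi> (norm (z - 0))) * ?d) \<partial>lborel)"
    by (rule polar[symmetric]) simp
  also have "\<dots> \<le> (\<integral>\<^sup>+z\<in>?A. ennreal (exp (2 * u z)) \<partial>lborel)"
  proof (rule nn_integral_mono)
    fix z
    have "exp (-2 * \<phi> (norm (z - 0))) * ?d \<le> exp (2 * u z)" if "z \<in> ?A"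
      using u[of z] that unfolding exp_add[symmetric] by (auto simp: abs_le_iff)
    then show "ennreal (exp (-2 * \<phi> (norm (z - 0))) * ?d) * indicator ?A z \<le> ennreal (exp (2 * u z)) * indicator ?A z"
      by (cases "z \<in> ?A") (simp_all add: ennreal_leI)
  qed
  finally show "ennreal (pi / 4 * ?d) \<le> conf_area u (ball 0 2 - ball 0 1)" unfolding area .
  let ?D = "exp (2 * c + 2 * B)"
  have "(\<integral>\<^sup>+z\<in>?A. ennreal (exp (2 * u z)) \<partial>lborel) \<le> (\<integral>\<^sup>+z\<in>?A. ennreal (exp (2 * \<phi> (norm (z - 0))) * ?D) \<partial>lborel)"
  proof (rule nn_integral_mono)
    fix z
    have "exp (2 * u z) \<le> exp (2 * \<phi> (norm (z - 0))) * ?D" if "z \<in> ?A"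
      using u[of z] that unfolding exp_add[symmetric] by (auto simp: abs_le_iff)
    then show "ennreal (exp (2 * u z)) * indicator ?A z \<le> ennreal (exp (2 * \<phi> (norm (z - 0))) * ?D) * indicator ?A z"
      by (cases "z \<in> ?A") (simp_all add: ennreal_leI)
  qed
  also have "\<dots> = ennreal (integral {1..2} (\<lambda>r. exp (2 * \<phi> r) * (r * (2 * pi * ?D))))"
    by (rule polar) simp
  also have "\<dots> \<le> ennreal (32 * pi * ?D)"
  proof (rule ennreal_leI)
    \<comment> \<open>Here the polar factor is bounded by r \<le> 2, whence 2 * 2 pi * 8 = 32
      pi.\<close>
    have "integral {1..2} (\<lambda>r. exp (2 * \<phi> r) * (r * (2 * pi * ?D)))
        \<le> integral {1..2} (\<lambda>r. (4 * pi * ?D) * exp (2 * \<phi> r))"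
    proof (rule integral_le)
      fix r :: real assume "r \<in> {1..2}"
      then have "r * (2 * pi * ?D) \<le> 2 * (2 * pi * ?D)" by (intro mult_right_mono) auto
      then have "exp (2 * \<phi> r) * (r * (2 * pi * ?D)) \<le> exp (2 * \<phi> r) * (2 * (2 * pi * ?D))"
        by (rule mult_left_mono) simp
      then show "exp (2 * \<phi> r) * (r * (2 * pi * ?D)) \<le> (4 * pi * ?D) * exp (2 * \<phi> r)" by (simp add: mult_ac)
    qed (auto intro!: integrable_continuous_interval continuous_intros c\<phi>)
    also have "\<dots> = (4 * pi * ?D) * integral {1..2} (\<lambda>r. exp (2 * \<phi> r))" by simp
    also have "\<dots> \<le> (4 * pi * ?D) * 8" using \<phi>(2) by (intro mult_left_mono) auto
    finally show "integral {1..2} (\<lambda>r. exp (2 * \<phi> r) * (r * (2 * pi * ?D))) \<le> 32 * pi * ?D" by simp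
  qed
  finally show "conf_area u (ball 0 2 - ball 0 1) \<le> ennreal (32 * pi * ?D)" unfolding area .
qed

text \<open>The conformal factors cancel, so the hypothesis on the curvature is an integral bound on
  the Laplacian, free of \<open>u\<close> itself.\<close>

lemma abs_gauss_curvature_mult_exp: "\<bar>gauss_curvature u z\<bar> * exp (2 * u z) = \<bar>laplacian u z\<bar>"
  by (simp add: gauss_curvature_def abs_mult exp_minus field_simps)

theorem theorem1p7:
  shows "\<forall>\<Lambda>\<^sub>3::real. \<Lambda>\<^sub>3 > 0 \<longrightarrow>
    (\<exists>\<epsilon>\<^sub>2::real. \<epsilon>\<^sub>2 > 0 \<and>
      (\<exists>C\<^sub>1 C\<^sub>2 C\<^sub>1' C\<^sub>2' :: real. C\<^sub>1 > 0 \<and> C\<^sub>2 > 0 \<and> C\<^sub>1' > 0 \<and> C\<^sub>2' > 0 \<and>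
        (\<forall>(u :: complex \<Rightarrow> real) c :: real.
          smooth_on (ball 0 4 - ball 0 (1/4)) u \<longrightarrow>
          weak_L2_norm (ball 0 4 - ball 0 (1/4)) (grad u) < ennreal \<Lambda>\<^sub>3 \<longrightarrow>
          c = circle_mean u (3/2) \<longrightarrow>
          (\<integral>\<^sup>+z\<in>ball 0 4 - ball 0 (1/2).
             ennreal (\<bar>gauss_curvature u z\<bar> * exp (2 * u z)) \<partial>lborel) < ennreal \<epsilon>\<^sub>2 \<longrightarrow>
          (\<forall>\<theta> \<theta>' :: real.
             ennreal C\<^sub>1 \<le> conf_dist (ball 0 4 - ball 0 (1/4)) u (cis \<theta>) (2 * cis \<theta>') / ennreal (exp c) \<and>
             conf_dist (ball 0 4 - ball 0 (1/4)) u (cis \<theta>) (2 * cis \<theta>') / ennreal (exp c) \<le> ennreal C\<^sub>2) \<and>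
          ennreal C\<^sub>1' \<le> conf_area u (ball 0 2 - ball 0 1) / ennreal (exp (2 * c)) \<and>
          conf_area u (ball 0 2 - ball 0 1) / ennreal (exp (2 * c)) \<le> ennreal C\<^sub>2')))"
proof (intro allI impI)
  fix \<Lambda> :: real assume \<Lambda>: "\<Lambda> > 0"
  let ?A = "ball 0 4 - ball 0 (1/4) :: complex set"
  let ?K = "{z. 1/2 \<le> norm z \<and> norm z \<le> 5/2} :: complex set"
  \<comment> \<open>\<open>?K\<close> is the union of the closed discs of radius 1/2 about the
    points with 1 \<le> |z| \<le> 2. \<open>X\<close> bounds the integral of |grad u| over it and is
    the only place where \<Lambda> enters; \<open>B\<close> is the resulting constant part of the
    bound on |u - c|.\<close>
  define X where "X = measure lborel ?K + 2 * \<Lambda>\<^sup>2"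
  define B where "B = 4 / pi * (5 * pi + 10) * X"
  have K: "?K \<in> sets borel" "?K \<subseteq> ?A" "?K \<subseteq> ball 0 4 - ball 0 (1/2)"
    by (auto intro!: borel_closed closed_Collect_conj closed_Collect_le continuous_intros)
  have "bounded ?K" by (rule bounded_subset[of "cball 0 (5/2)"]) auto
  then have fin: "emeasure lborel ?K < \<infinity>" by (rule emeasure_bounded_finite)
  have X0: "0 \<le> X" by (simp add: X_def)
  have dist_bounds: "ennreal (exp (- B) / 72) \<le> conf_dist ?A u (cis \<theta>) (2 * cis \<theta>') / ennreal (exp c) \<and>
      conf_dist ?A u (cis \<theta>) (2 * cis \<theta>') / ennreal (exp c) \<le> ennreal ((1 + 4 * pi) * 8 * exp B)" (is ?dist)
    and area_bounds: "ennreal (pi / 4 * exp (- 2 * B)) \<le> conf_area u (ball 0 2 - ball 0 1) / ennreal (exp (2 * c)) \<and>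
      conf_area u (ball 0 2 - ball 0 1) / ennreal (exp (2 * c)) \<le> ennreal (32 * pi * exp (2 * B))" (is ?area)
    if u: "smooth_on ?A u" and w: "weak_L2_norm ?A (grad u) < ennreal \<Lambda>" and c: "c = circle_mean u (3/2)"
      and curv: "(\<integral>\<^sup>+z\<in>ball 0 4 - ball 0 (1/2). ennreal (\<bar>gauss_curvature u z\<bar> * exp (2 * u z)) \<partial>lborel) < ennreal (1/2)"
    for u c \<theta> \<theta>'
  proof -
    have 1: "(\<integral>\<^sup>+z\<in>?K. ennreal \<bar>laplacian u z\<bar> \<partial>lborel) \<le> ennreal (1/2)"
    proof -
      have "(\<integral>\<^sup>+z\<in>?K. ennreal \<bar>laplacian u z\<bar> \<partial>lborel)
          \<le> (\<integral>\<^sup>+z\<in>ball 0 4 - ball 0 (1/2). ennreal \<bar>laplacian u z\<bar> \<partial>lborel)"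
        using K(3) by (intro nn_integral_mono mult_left_mono) (auto simp: indicator_def)
      with curv show ?thesis unfolding abs_gauss_curvature_mult_exp by simp
    qed
    have "(\<integral>\<^sup>+z\<in>?K. ennreal (norm (grad u z)) \<partial>lborel) \<le> emeasure lborel ?K + ennreal (2 * \<Lambda>\<^sup>2)"
      by (rule nn_integral_norm_le_weak_L2[OF w \<Lambda> continuous_on_grad[OF u] _ K(1,2)]) auto
    also have "\<dots> = ennreal X"
      using fin by (simp add: X_def ennreal_plus emeasure_eq_ennreal_measure less_top)
    finally have 2: "(\<integral>\<^sup>+z\<in>?K. ennreal (norm (grad u z)) \<partial>lborel) \<le> ennreal X" .
    obtain \<phi> where \<phi>: "\<And>S. continuous_on S \<phi>" "\<And>r. 0 \<le> \<phi> r" "integral {1..2} (\<lambda>r. exp (2 * \<phi> r)) \<le> 8"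
      and b: "\<And>z. 1 \<le> norm z \<Longrightarrow> norm z \<le> 2 \<Longrightarrow> \<bar>u z - c\<bar> \<le> B + \<phi> (norm z)"
      using conformal_factor_bound[OF smooth_on_subset[OF u K(2)] 1 2 X0] unfolding B_def c by metis
    have div: "ennreal (s * exp d) / ennreal (exp d) = ennreal s" if "0 \<le> s" for s d
      using that by (simp add: divide_ennreal)
    have "ennreal (exp (c - B) / 72) \<le> conf_dist ?A u (cis \<theta>) (2 * cis \<theta>')"
      by (rule conf_dist_lower_bound[OF \<phi>]) (use b in \<open>auto simp: abs_le_iff norm_mult algebra_simps\<close>)
    moreover have "exp (c - B) / 72 = exp (- B) / 72 * exp c" by (simp add: exp_diff exp_minus field_simps)
    moreover have "conf_dist ?A u (cis \<theta>) (2 * cis \<theta>') \<le> ennreal ((1 + 4 * pi) * 8 * exp (c + B))"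
      by (rule conf_dist_upper_bound[OF \<phi>]) (use b in \<open>auto simp: abs_le_iff algebra_simps\<close>)
    moreover have "(1 + 4 * pi) * 8 * exp (c + B) = (1 + 4 * pi) * 8 * exp B * exp c" by (simp add: exp_add)
    ultimately show ?dist
      using divide_right_mono_ennreal[of _ _ "ennreal (exp c)"] div[of _ c]
      by (metis add_nonneg_nonneg divide_nonneg_nonneg exp_ge_zero mult_nonneg_nonneg pi_ge_zero zero_le_numeral zero_le_one)
    have "ennreal (pi / 4 * exp (2 * c - 2 * B)) \<le> conf_area u (ball 0 2 - ball 0 1)"
      "conf_area u (ball 0 2 - ball 0 1) \<le> ennreal (32 * pi * exp (2 * c + 2 * B))"
      using conf_area_bounds[OF \<phi>(1,3) b] by auto
    moreover have "pi / 4 * exp (2 * c - 2 * B) = pi / 4 * exp (- 2 * B) * exp (2 * c)"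
      "32 * pi * exp (2 * c + 2 * B) = 32 * pi * exp (2 * B) * exp (2 * c)"
      by (simp_all add: exp_diff exp_minus exp_add field_simps)
    ultimately show ?area
      using divide_right_mono_ennreal[of _ _ "ennreal (exp (2 * c))"] div[of _ "2 * c"]
      by (metis divide_nonneg_nonneg exp_ge_zero mult_nonneg_nonneg pi_ge_zero zero_le_numeral)
  qed
  show "\<exists>\<epsilon>\<^sub>2>0. \<exists>C\<^sub>1 C\<^sub>2 C\<^sub>1' C\<^sub>2'. C\<^sub>1 > 0 \<and> C\<^sub>2 > 0 \<and> C\<^sub>1' > 0 \<and> C\<^sub>2' > 0 \<and>
        (\<forall>(u :: complex \<Rightarrow> real) c :: real.
          smooth_on ?A u \<longrightarrow> weak_L2_norm ?A (grad u) < ennreal \<Lambda> \<longrightarrow> c = circle_mean u (3/2) \<longrightarrow>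
          (\<integral>\<^sup>+z\<in>ball 0 4 - ball 0 (1/2).
             ennreal (\<bar>gauss_curvature u z\<bar> * exp (2 * u z)) \<partial>lborel) < ennreal \<epsilon>\<^sub>2 \<longrightarrow>
          (\<forall>\<theta> \<theta>' :: real.
             ennreal C\<^sub>1 \<le> conf_dist ?A u (cis \<theta>) (2 * cis \<theta>') / ennreal (exp c) \<and>
             conf_dist ?A u (cis \<theta>) (2 * cis \<theta>') / ennreal (exp c) \<le> ennreal C\<^sub>2) \<and>
          ennreal C\<^sub>1' \<le> conf_area u (ball 0 2 - ball 0 1) / ennreal (exp (2 * c)) \<and>
          conf_area u (ball 0 2 - ball 0 1) / ennreal (exp (2 * c)) \<le> ennreal C\<^sub>2')"
  proof (rule exI[of _ "1/2"], rule conjI[OF _ exI[of _ "exp (- B) / 72"]], simp,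
      rule exI[of _ "(1 + 4 * pi) * 8 * exp B"], rule exI[of _ "pi / 4 * exp (- 2 * B)"],
      rule exI[of _ "32 * pi * exp (2 * B)"], intro conjI allI impI)
    fix u c
    assume u: "smooth_on ?A u" "weak_L2_norm ?A (grad u) < ennreal \<Lambda>" "c = circle_mean u (3/2)"
      "(\<integral>\<^sup>+z\<in>ball 0 4 - ball 0 (1/2). ennreal (\<bar>gauss_curvature u z\<bar> * exp (2 * u z)) \<partial>lborel) < ennreal (1/2)"
    show "ennreal (exp (- B) / 72) \<le> conf_dist ?A u (cis \<theta>) (2 * cis \<theta>') / ennreal (exp c)"
      "conf_dist ?A u (cis \<theta>) (2 * cis \<theta>') / ennreal (exp c) \<le> ennreal ((1 + 4 * pi) * 8 * exp B)" for \<theta> \<theta>'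
      using dist_bounds[OF u] by auto
    show "ennreal (pi / 4 * exp (- 2 * B)) \<le> conf_area u (ball 0 2 - ball 0 1) / ennreal (exp (2 * c))"
      "conf_area u (ball 0 2 - ball 0 1) / ennreal (exp (2 * c)) \<le> ennreal (32 * pi * exp (2 * B))"
      using area_bounds[OF u] by auto
  qed (simp_all add: add_pos_pos)
qed

end
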